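(* Let $(\mathcal V,d,\mu)$ be the weighted homogeneous tree of order $q+1$ and, for $p\in(1,\infty]$, let $H^{1,p}(\mu)$ be the atomic Hardy space on it, as defined in the context. Then for every $p\in(1,\infty)$ one has $H^{1,p}(\mu)=H^{1,\infty}(\mu)$, and the norms $\|\cdot\|_{H^{1,p}}$ and $\|\cdot\|_{H^{1,\infty}}$ are equivalent.
   Context: Weighted tree. Fix an integer $q\ge 2$. $\mathcal V$ is the vertex set of the infinite homogeneous tree of order $q+1$, i.e. the connected acyclic graph in which every vertex has exactly $q+1$ neighbours; $d$ is the graph distance. Fix a doubly-infinite geodesic $g\subset\mathcal V$ (a connected subset in which every element has exactly two neighbours belonging to $g$ and which contains the shortest path between any two of its elements) and a map $N:g\to\mathbb Z$ with $|N(x)-N(y)|=d(x,y)$ for all $x,y\in g$. The level function $\ell:\mathcal V\to\mathbb Z$ is $\ell(x)=N(x')-d(x,x')$, where $x'$ is the unique vertex of $g$ closest to $x$. The measure $\mu$ on $\mathcal V$ is $\int_{\mathcal V}f\,d\mu=\sum_{x\in\mathcal V}f(x)q^{\ell(x)}$. A vertex $x$ lies below a vertex $y$ if $\ell(x)=\ell(y)-d(x,y)$. Calderón–Zygmund sets. An admissible trapezoid is a set $R\subset\mathcal V$ that is either a single vertex $R=\{x_R\}$ (degenerate case; put $h(R)=1$), or of the form $R=\{x\in\mathcal V: x\text{ lies below }x_R,\ h\le \ell(x_R)-\ell(x)<2h\}$ for some $x_R\in\mathcal V$ and some integer $h\ge1$ (put $h(R)=h$). The envelope of $R$ is $\tilde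 R=\{x\in\mathcal V: x\text{ lies below }x_R,\ \tfrac h2\le \ell(x_R)-\ell(x)<4h\}$ in the nondegenerate case, and $\tilde R=R$ in the degenerate case. A Calderón–Zygmund set is the envelope of an admissible trapezoid. Hardy spaces. For $p\in(1,\infty]$, a $(1,p)$-atom is a function $a:\mathcal V\to\mathbb C$ such that: $a$ is supported in a Calderón–Zygmund set $\tilde R$; $\|a\|_{L^p(\mu)}\le\mu(\tilde R)^{1/p-1}$ (with $1/\infty=0$); and $\int_{\mathcal V}a\,d\mu=0$. $H^{1,p}(\mu)$ is the space of all $h\in L^1(\mu)$ of the form $h=\sum_j\lambda_ja_j$ (convergence in $L^1(\mu)$) with $a_j$ $(1,p)$-atoms and $\lambda_j\in\mathbb C$, $\sum_j|\lambda_j|<\infty$; $\|h\|_{H^{1,p}}$ is the infimum of $\sum_j|\lambda_j|$ over all such decompositions. *)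

theory Defs
  imports "HOL-Analysis.Analysis" "HOL-Probability.Essential_Supremum"
begin

(* The vertex set is the whole type 'v.  A cycle is a list of at least three distinct
   vertices, consecutive ones adjacent, whose last vertex is adjacent to its first. *)
locale homogeneous_tree =
  fixes adj :: "'v \<Rightarrow> 'v \<Rightarrow> bool" and q :: nat
  assumes q_ge_2: "q \<ge> 2"
    and adj_sym: "adj x y \<Longrightarrow> adj y x"
    and adj_irrefl: "\<not> adj x x"
    and graph_connected: "adj\<^sup>*\<^sup>* x y"
    and graph_acyclic:
      "\<not> (\<exists>xs. length xs \<ge> 3 \<and> distinct xs \<and> successively adj xs \<and> adj (last xs) (hd xs))"
    and degree: "card {y. adj x y} = q + 1"
begin

definition gdist :: "'v \<Rightarrow> 'v \<Rightarrow> nat" where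
  "gdist x y = (LEAST n. (adj ^^ n) x y)"

definition shortest_path :: "'v list \<Rightarrow> 'v \<Rightarrow> 'v \<Rightarrow> bool" where
  "shortest_path xs x y \<longleftrightarrow>
     xs \<noteq> [] \<and> hd xs = x \<and> last xs = y \<and> successively adj xs \<and> length xs = gdist x y + 1"

definition infinite_geodesic :: "'v set \<Rightarrow> bool" where
  "infinite_geodesic g \<longleftrightarrow>
     g \<noteq> {} \<and>
     (\<forall>x\<in>g. \<forall>y\<in>g. (\<lambda>u v. adj u v \<and> u \<in> g \<and> v \<in> g)\<^sup>*\<^sup>* x y) \<and>
     (\<forall>x\<in>g. card {y \<in> g. adj x y} = 2) \<and>
     (\<forall>x\<in>g. \<forall>y\<in>g. \<forall>xs. shortest_path xs x y \<longrightarrow> set xs \<subseteq> g)"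

end

(* Only the values of N on g matter. *)
locale weighted_tree = homogeneous_tree adj q
  for adj :: "'v \<Rightarrow> 'v \<Rightarrow> bool" and q :: nat +
  fixes g :: "'v set" and N :: "'v \<Rightarrow> int"
  assumes geodesic: "infinite_geodesic g"
    and N_isometry: "\<lbrakk>x \<in> g; y \<in> g\<rbrakk> \<Longrightarrow> \<bar>N x - N y\<bar> = int (gdist x y)"
begin

definition proj :: "'v \<Rightarrow> 'v" where
  "proj x = (THE x'. is_arg_min (gdist x) (\<lambda>y. y \<in> g) x')"

definition level :: "'v \<Rightarrow> int" where
  "level x = N (proj x) - int (gdist x (proj x))"

definition mu :: "'v measure" where
  "mu = point_measure UNIV (\<lambda>x. ennreal (real q powi level x))"

definition below :: "'v \<Rightarrow> 'v \<Rightarrow> bool" where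
  "below x y \<longleftrightarrow> level x = level y - int (gdist x y)"

definition trapezoid :: "'v \<Rightarrow> nat \<Rightarrow> 'v set" where
  "trapezoid xR h =
     {x. below x xR \<and> int h \<le> level xR - level x \<and> level xR - level x < 2 * int h}"

definition trapezoid_envelope :: "'v \<Rightarrow> nat \<Rightarrow> 'v set" where
  "trapezoid_envelope xR h =
     {x. below x xR \<and> real h / 2 \<le> real_of_int (level xR - level x)
                    \<and> level xR - level x < 4 * int h}"

(* R is an admissible trapezoid and S is its envelope; the first disjunct is the
   degenerate case. *)
definition is_envelope_of :: "'v set \<Rightarrow> 'v set \<Rightarrow> bool" where
  "is_envelope_of S R \<longleftrightarrow>
     (\<exists>xR. R = {xR} \<and> S = R) \<or>
     (\<exists>xR h. h \<ge> 1 \<and> R = trapezoid xR h \<and> S = trapezoid_envelope xR h)"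

definition CZ_set :: "'v set \<Rightarrow> bool" where
  "CZ_set S \<longleftrightarrow> (\<exists>R. is_envelope_of S R)"

(* For p in [1, infinity]; the value is infinite when f is not in L^p.  Every function is
   mu-measurable, and mu charges every point, so functions equal mu-a.e. are equal. *)
definition Lp_norm :: "ereal \<Rightarrow> ('v \<Rightarrow> complex) \<Rightarrow> ereal" where
  "Lp_norm p f =
     (if p = \<infinity> then esssup mu (\<lambda>x. ereal (cmod (f x)))
      else let I = (\<integral>\<^sup>+x. ennreal (cmod (f x) powr real_of_ereal p) \<partial>mu)
           in if I = \<infinity> then \<infinity> else ereal (enn2real I powr (1 / real_of_ereal p)))"

(* Calderon-Zygmund sets are finite, so every a below is mu-integrable, and the real-valued
   measure of S is its actual measure.  For p = infinity, 1 / p = 0 in ereal. *)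
definition atom :: "ereal \<Rightarrow> ('v \<Rightarrow> complex) \<Rightarrow> bool" where
  "atom p a \<longleftrightarrow>
     (\<exists>S. CZ_set S \<and> (\<forall>x. a x \<noteq> 0 \<longrightarrow> x \<in> S) \<and>
          Lp_norm p a \<le> ereal (measure mu S powr (real_of_ereal (1 / p) - 1))) \<and>
     (\<integral>x. a x \<partial>mu) = 0"

(* Finite sums are covered, since coefficients may vanish. *)
definition atomic_decomposition ::
  "ereal \<Rightarrow> ('v \<Rightarrow> complex) \<Rightarrow> (nat \<Rightarrow> complex) \<Rightarrow> (nat \<Rightarrow> 'v \<Rightarrow> complex) \<Rightarrow> bool" where
  "atomic_decomposition p h c a \<longleftrightarrow>
     (\<forall>j. atom p (a j)) \<and> summable (\<lambda>j. cmod (c j)) \<and>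
     (\<lambda>n. Lp_norm 1 (\<lambda>x. h x - (\<Sum>j<n. c j * a j x))) \<longlonglongrightarrow> 0"

definition hardy_space :: "ereal \<Rightarrow> ('v \<Rightarrow> complex) set" where
  "hardy_space p = {h. integrable mu h \<and> (\<exists>c a. atomic_decomposition p h c a)}"

(* Meaningful for h in hardy_space p only: otherwise the infimum is over the empty set. *)
definition hardy_norm :: "ereal \<Rightarrow> ('v \<Rightarrow> complex) \<Rightarrow> real" where
  "hardy_norm p h = Inf {\<Sum>j. cmod (c j) | c. \<exists>a. atomic_decomposition p h c a}"

end

end

theory Submission
  imports Defs
begin

text \<open>The inequality norm(p) <= norm(infinity) is immediate, since an atom bounded by 1/mu(S) on a
Calderon-Zygmund set S is also a (1,p)-atom. The point is the converse: every (1,p)-atom is a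
finite sum of multiples of (1,infinity)-atoms whose coefficients have total size at most a constant
depending only on p and q.

The geodesic and its labelling N single out an end of the tree. Exactly one neighbour of a vertex,
its parent, is one level higher (\<open>unique_higher_neighbour\<close>), and "below" means "descendant of"
(\<open>below_iff\<close>). A vertex has q children, each carrying 1/q of its weight, so all generations of
descendants of a vertex x have the same mass as x. Hence the band of descendants of x at depths
a <= k < b has mass (b - a) weight(x), and a Calderon-Zygmund set is a point or a band with
2a <= b <= 8a.

Such bands can be cut again and again, down to points, into bands of the same shape and of
comparable mass (\<open>dyadic_band\<close>): a tall band with b >= 4a is cut at depth 2a; otherwise the band is
distributed over the children of x, which lowers both depths by one, until at most two generations
are left, which are cut into points. Every piece lies in a Calderon-Zygmund set of comparable mass,
so bounded functions of mean zero on a piece are multiples of atoms. The pieces take the role of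
dyadic cubes.

Let A(Q) be the L^p mean of f over a piece Q. Stop the subdivision of Q at the first pieces R with
A(R) > 2 A(Q) (\<open>stopping_family\<close>). The oscillation f - avg(f,Q) on Q is the sum of the oscillations on
the stopping pieces R and of a remainder of mean zero which is bounded by a multiple of A(Q). The
remainder costs a multiple of A(Q) mu(Q). For the stopping pieces, A(R) <= A(R)^p (2 A(Q))^(1-p),
and summation gives that the sum of A(R) mu(R) is at most 2^(1-p) A(Q) mu(Q) (\<open>stopped_mass\<close>). As
2^(1-p) < 1, iteration gives a geometric series, and the oscillation on Q costs at most a constant
times A(Q) mu(Q) (\<open>oscillation_atomic\<close>). An atom is its own oscillation on its set S, and
A(S) mu(S) <= 1.

Finally, decomposing each atom of a series gives a double series that converges absolutely, and
it can be rearranged pointwise because every vertex has positive mass.\<close>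

section \<open>The parent of a vertex\<close>

text \<open>A walk visiting a vertex twice is shortened by cutting out the loop.\<close>
lemma rtranclp_imp_distinct_walk:
  assumes "r\<^sup>*\<^sup>* x y"
  shows "\<exists>xs. xs \<noteq> [] \<and> hd xs = x \<and> last xs = y \<and> successively r xs \<and> distinct xs"
  using assms
proof (induction rule: converse_rtranclp_induct)
  case base
  show ?case by (rule exI[of _ "[y]"]) simp
next
  case (step x u)
  then obtain xs where xs: "xs \<noteq> []" "hd xs = u" "last xs = y" "successively r xs" "distinct xs"
    by blast
  show ?case
  proof (cases "x \<in> set xs")
    case True
    then obtain as bs where "xs = as @ x # bs" by (meson split_list)
    with xs show ?thesis
      by (intro exI[of _ "x # bs"]) (auto simp: successively_append_iff)
  next
    case False
    with xs step show ?thesis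
      by (intro exI[of _ "x # xs"]) (auto simp: successively_Cons)
  qed
qed

lemma successively_avoids:
  assumes "successively (\<lambda>u v. r u v \<and> v \<noteq> z) xs" "hd xs \<noteq> z"
  shows "z \<notin> set xs"
  using assms by (induction xs) (auto simp: successively_Cons)

context homogeneous_tree
begin

text \<open>Removing z separates its neighbours, because a path between two of them that avoids z would
close up to a cycle through z. All uses of acyclicity go through this lemma.\<close>
lemma neighbours_separated:
  assumes "adj z y1" "adj z y2" "y1 \<noteq> y2"
  shows "\<not> (\<lambda>u v. adj u v \<and> v \<noteq> z)\<^sup>*\<^sup>* y1 y2"
proof
  assume *: "(\<lambda>u v. adj u v \<and> v \<noteq> z)\<^sup>*\<^sup>* y1 y2"
  obtain xs where xs: "xs \<noteq> []" "hd xs = y1" "last xs = y2" "distinct xs"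
      "successively (\<lambda>u v. adj u v \<and> v \<noteq> z) xs"
    using rtranclp_imp_distinct_walk[OF *] by blast
  have "z \<noteq> y1" using assms(1) adj_irrefl by metis
  then have "z \<notin> set xs" using successively_avoids[of adj z xs] xs(2,5) by simp
  moreover have "successively adj xs"
    using xs(5) by (rule successively_mono) auto
  moreover have "length xs \<ge> 2"
    using xs(1-3) assms(3) by (cases xs; cases "tl xs") auto
  ultimately have "length (z # xs) \<ge> 3 \<and> distinct (z # xs) \<and> successively adj (z # xs)
      \<and> adj (last (z # xs)) (hd (z # xs))"
    using xs assms adj_sym by (auto simp: successively_Cons)
  then show False using graph_acyclic by blast
qed

lemma gdist_walk: "(adj ^^ gdist x y) x y"
proof -
  obtain n where "(adj ^^ n) x y" using graph_connected rtranclp_imp_relpowp by metis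
  then show ?thesis unfolding gdist_def by (rule LeastI)
qed

lemma gdist_le: "(adj ^^ n) x y \<Longrightarrow> gdist x y \<le> n"
  unfolding gdist_def by (rule Least_le)

lemma gdist_eq_0_iff [simp]: "gdist x y = 0 \<longleftrightarrow> x = y"
  using gdist_walk[of x y] gdist_le[of 0 x y] by auto

lemma gdist_self [simp]: "gdist x x = 0"
  by simp

lemma gdist_adj: "adj x y \<Longrightarrow> gdist x z \<le> gdist y z + 1"
  using gdist_le[OF relpowp_Suc_I2[OF _ gdist_walk]] by simp

lemma gdist_step:
  assumes "gdist x z = Suc n"
  shows "\<exists>y. adj x y \<and> gdist y z = n"
proof -
  have "(adj ^^ Suc n) x z" using gdist_walk[of x z] assms by simp
  then obtain y where y: "adj x y" "(adj ^^ n) y z" by (metis relpowp_Suc_D2)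
  with gdist_adj[OF y(1), of z] gdist_le[OF y(2)] assms show ?thesis by auto
qed

lemma finite_neighbours: "finite {y. adj x y}"
  using degree[of x] card.infinite by fastforce

end

context weighted_tree
begin

definition dist_g :: "'v \<Rightarrow> nat" where
  "dist_g x = (LEAST n. \<exists>z\<in>g. gdist x z = n)"

lemma dist_g_attained: "\<exists>z\<in>g. gdist x z = dist_g x"
proof -
  obtain z where "z \<in> g" using geodesic unfolding infinite_geodesic_def by blast
  then have "\<exists>n. \<exists>z\<in>g. gdist x z = n" by blast
  then show ?thesis unfolding dist_g_def by (rule LeastI_ex)
qed

lemma dist_g_le: "z \<in> g \<Longrightarrow> dist_g x \<le> gdist x z"
  unfolding dist_g_def by (rule Least_le) blast

lemma dist_g_eq_0_iff [simp]: "dist_g x = 0 \<longleftrightarrow> x \<in> g"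
proof
  show "x \<in> g" if "dist_g x = 0" using dist_g_attained[of x] that by auto
  show "dist_g x = 0" if "x \<in> g" using dist_g_le[OF that, of x] by simp
qed

lemma dist_g_adj: assumes "adj x y" shows "dist_g x \<le> dist_g y + 1"
proof -
  obtain z where z: "z \<in> g" "gdist y z = dist_g y" using dist_g_attained by blast
  show ?thesis using dist_g_le[OF z(1), of x] gdist_adj[OF assms, of z] z by linarith
qed

lemma closer_neighbour:
  assumes "z \<in> g" "gdist x z = dist_g x" "x \<notin> g"
  shows "\<exists>y. adj x y \<and> dist_g x = Suc (dist_g y) \<and> gdist y z = dist_g y"
proof -
  have "dist_g x \<noteq> 0" using assms by simp
  then obtain n where n: "dist_g x = Suc n" using not0_implies_Suc by blast
  with assms obtain y where y: "adj x y" "gdist y z = n" using gdist_step by metis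
  have "dist_g y \<le> n" using dist_g_le[OF assms(1), of y] y by simp
  moreover have "Suc n \<le> dist_g y + 1" using dist_g_adj[OF y(1)] n by simp
  ultimately show ?thesis using y n by auto
qed

text \<open>A shortest path from y to the geodesic passes, after y, only through vertices closer to the
geodesic than y, hence misses x.\<close>
lemma reaches_g_avoiding:
  assumes "x \<notin> g" "y \<noteq> x" "dist_g y \<le> dist_g x"
  shows "\<exists>z\<in>g. (\<lambda>u v. adj u v \<and> u \<noteq> x \<and> v \<noteq> x)\<^sup>*\<^sup>* y z"
  using assms(2,3)
proof (induction "dist_g y" arbitrary: y)
  case 0
  then show ?case by auto
next
  case (Suc n)
  then have "y \<notin> g" using dist_g_eq_0_iff by (metis nat.distinct(1))
  then obtain y' where y': "adj y y'" "dist_g y = Suc (dist_g y')"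
    using closer_neighbour dist_g_attained by metis
  then have "y' \<noteq> x" "n = dist_g y'" "dist_g y' \<le> dist_g x" using Suc by auto
  with Suc(1)[of y'] obtain z where
    "z \<in> g" "(\<lambda>u v. adj u v \<and> u \<noteq> x \<and> v \<noteq> x)\<^sup>*\<^sup>* y' z" by blast
  with y' \<open>y' \<noteq> x\<close> Suc show ?case
    by (intro bexI[of _ z] converse_rtranclp_into_rtranclp[of _ y y']) auto
qed

text \<open>Two such neighbours would be joined, via the geodesic, by a path that avoids x. Allowing equal
distance in the hypotheses also excludes neighbours at the same distance as x.\<close>
lemma closer_neighbour_unique:
  assumes "x \<notin> g" "adj x y1" "adj x y2" "dist_g y1 \<le> dist_g x" "dist_g y2 \<le> dist_g x"
  shows "y1 = y2"
proof (rule ccontr)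
  let ?r = "\<lambda>u v. adj u v \<and> u \<noteq> x \<and> v \<noteq> x"
  assume "y1 \<noteq> y2"
  have "y1 \<noteq> x" "y2 \<noteq> x" using assms(2,3) adj_irrefl by auto
  then obtain z1 z2 where z: "z1 \<in> g" "?r\<^sup>*\<^sup>* y1 z1" "z2 \<in> g" "?r\<^sup>*\<^sup>* y2 z2"
    using reaches_g_avoiding assms by meson
  have "(\<lambda>u v. adj u v \<and> u \<in> g \<and> v \<in> g)\<^sup>*\<^sup>* z1 z2"
    using z geodesic unfolding infinite_geodesic_def by blast
  then have "?r\<^sup>*\<^sup>* z1 z2"
    by (rule rtranclp_mono[THEN predicate2D, rotated]) (use assms(1) in auto)
  moreover have "symp ?r" using adj_sym by (auto simp: symp_def)
  then have "?r\<^sup>*\<^sup>* z2 y2" using z(4) symp_rtranclp sympD by fast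
  ultimately have "?r\<^sup>*\<^sup>* y1 y2" using z(2) by auto
  then have "(\<lambda>u v. adj u v \<and> v \<noteq> x)\<^sup>*\<^sup>* y1 y2"
    by (rule rtranclp_mono[THEN predicate2D, rotated]) auto
  then show False using neighbours_separated assms \<open>y1 \<noteq> y2\<close> by blast
qed

lemma nearest_point_unique:
  assumes "z1 \<in> g" "z2 \<in> g" "gdist x z1 = dist_g x" "gdist x z2 = dist_g x"
  shows "z1 = z2"
  using assms(3,4)
proof (induction "dist_g x" arbitrary: x)
  case 0
  then show ?case by (metis gdist_eq_0_iff)
next
  case (Suc n)
  then have x: "x \<notin> g" by (metis dist_g_eq_0_iff nat.distinct(1))
  obtain y1 where y1: "adj x y1" "dist_g x = Suc (dist_g y1)" "gdist y1 z1 = dist_g y1"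
    using closer_neighbour assms Suc x by metis
  obtain y2 where y2: "adj x y2" "dist_g x = Suc (dist_g y2)" "gdist y2 z2 = dist_g y2"
    using closer_neighbour assms Suc x by metis
  have "y1 = y2" using closer_neighbour_unique[OF x y1(1) y2(1)] y1 y2 by simp
  then show ?case using Suc y1 y2 by simp
qed

lemma proj_eqI:
  assumes "z \<in> g" "gdist x z = dist_g x"
  shows "proj x = z"
  unfolding proj_def
proof (rule the_equality)
  show "is_arg_min (gdist x) (\<lambda>y. y \<in> g) z"
    using assms dist_g_le by (auto simp: is_arg_min_def not_less)
next
  fix z' assume z': "is_arg_min (gdist x) (\<lambda>y. y \<in> g) z'"
  then have "z' \<in> g" "gdist x z' \<le> gdist x z"
    using assms by (auto simp: is_arg_min_def not_less)
  then show "z' = z"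
    using dist_g_le[of z' x] assms by (intro nearest_point_unique[of z' z x]) auto
qed

lemma level_eq: "level x = N (proj x) - int (dist_g x)"
proof -
  obtain z where "z \<in> g" "gdist x z = dist_g x" using dist_g_attained by blast
  then show ?thesis unfolding level_def using proj_eqI by metis
qed

lemma level_on_g: "x \<in> g \<Longrightarrow> level x = N x"
  using level_eq[of x] proj_eqI[of x x] by simp

lemma level_closer_neighbour:
  assumes "adj x y" "dist_g x = Suc (dist_g y)"
  shows "level y = level x + 1"
proof -
  have x: "x \<notin> g" using assms(2) by (metis dist_g_eq_0_iff nat.distinct(1))
  obtain z where z: "z \<in> g" "gdist x z = dist_g x" using dist_g_attained by blast
  obtain y' where y': "adj x y'" "dist_g x = Suc (dist_g y')" "gdist y' z = dist_g y'"
    using closer_neighbour[OF z x] by blast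
  have "y' = y"
    by (rule closer_neighbour_unique[OF x y'(1) assms(1)]) (use y'(2) assms(2) in linarith)+
  then have "proj y = z" "proj x = z" using proj_eqI z y' by auto
  then show ?thesis using level_eq[of x] level_eq[of y] assms by simp
qed

text \<open>Off the geodesic the higher neighbour is the one on the way to the geodesic. On the geodesic it
is the successor in the direction of increasing N: the labels of the two neighbours on the geodesic
are distinct and both differ from the label of x by one.\<close>
lemma unique_higher_neighbour:
  "\<exists>y. adj x y \<and> level y = level x + 1 \<and> (\<forall>z. adj x z \<and> z \<noteq> y \<longrightarrow> level z = level x - 1)"
proof (cases "x \<in> g")
  case False
  obtain y where y: "adj x y" "dist_g x = Suc (dist_g y)"
    using closer_neighbour dist_g_attained False by metis
  have "level z = level x - 1" if z: "adj x z" "z \<noteq> y" for z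
  proof -
    have "\<not> dist_g z \<le> dist_g x"
      using closer_neighbour_unique[OF False z(1) y(1)] y z by auto
    then have "dist_g z = Suc (dist_g x)" using dist_g_adj[OF adj_sym[OF z(1)]] by linarith
    then show ?thesis using level_closer_neighbour[OF adj_sym[OF z(1)]] by simp
  qed
  then show ?thesis using y level_closer_neighbour[OF y] by (intro exI[of _ y]) simp
next
  case True
  have "card {y \<in> g. adj x y} = 2"
    using True geodesic unfolding infinite_geodesic_def by blast
  then obtain u v where uv: "{y \<in> g. adj x y} = {u, v}" "u \<noteq> v" by (meson card_2_iff)
  then have m: "u \<in> g" "v \<in> g" "adj x u" "adj x v" by auto
  have step: "\<bar>level z - level x\<bar> = 1" if "z \<in> g" "adj x z" for z
  proof -
    have "gdist x z \<noteq> 0" using that adj_irrefl by auto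
    moreover have "gdist x z \<le> 1" using gdist_adj[OF that(2), of z] by simp
    ultimately have "gdist x z = 1" by linarith
    then show ?thesis using N_isometry[of x z] level_on_g True that by force
  qed
  have "level u \<noteq> level v"
    using N_isometry[of u v] m uv(2) level_on_g by auto
  then have "level u = level x + 1 \<and> level v = level x - 1 \<or>
             level v = level x + 1 \<and> level u = level x - 1"
    using step[OF m(1,3)] step[OF m(2,4)] by linarith
  moreover have "level z = level x - 1" if z: "adj x z" "z \<noteq> u" "z \<noteq> v" for z
  proof -
    have "z \<notin> g" using z uv by blast
    then have "dist_g z \<noteq> 0" by simp
    moreover have "dist_g x = 0" using True by simp
    ultimately have "dist_g z = Suc (dist_g x)" using dist_g_adj[OF adj_sym[OF z(1)]] by linarith
    then show ?thesis using level_closer_neighbour[OF adj_sym[OF z(1)]] by simp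
  qed
  ultimately show ?thesis using m by metis
qed

text \<open>All three properties are part of the choice, so that they follow together from
\<open>unique_higher_neighbour\<close>.\<close>
definition parent :: "'v \<Rightarrow> 'v" where
  "parent x = (SOME y. adj x y \<and> level y = level x + 1 \<and>
                       (\<forall>z. adj x z \<and> z \<noteq> y \<longrightarrow> level z = level x - 1))"

lemma adj_parent: "adj x (parent x)"
  and level_parent [simp]: "level (parent x) = level x + 1"
  and level_other: "adj x z \<Longrightarrow> z \<noteq> parent x \<Longrightarrow> level z = level x - 1"
  using someI_ex[OF unique_higher_neighbour[of x]] unfolding parent_def by blast+

lemma parent_eqI: "adj x y \<Longrightarrow> level y = level x + 1 \<Longrightarrow> parent x = y"
  using level_other[of x y] by force

lemma children_eq: "{y. parent y = x} = {y. adj x y} - {parent x}"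
proof (intro equalityI subsetI)
  fix y assume "y \<in> {y. parent y = x}"
  then have y: "parent y = x" by simp
  have "y \<noteq> parent x"
  proof
    assume *: "y = parent x"
    have "level x = level y + 1" using y level_parent by metis
    moreover have "level y = level x + 1" using * by simp
    ultimately show False by simp
  qed
  then show "y \<in> {y. adj x y} - {parent x}" using y adj_parent adj_sym by blast
next
  fix y assume "y \<in> {y. adj x y} - {parent x}"
  then show "y \<in> {y. parent y = x}"
    using level_other[of x y] adj_sym by (auto intro!: parent_eqI)
qed

lemma finite_children: "finite {y. parent y = x}"
  and card_children: "card {y. parent y = x} = q"
  unfolding children_eq using finite_neighbours degree[of x] adj_parent
  by (auto simp: card_Diff_singleton)

lemma level_funpow_parent [simp]: "level ((parent ^^ k) x) = level x + int k"
  by (induction k) auto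

lemma level_le_gdist: "level y \<le> level x + int (gdist x y)"
proof (induction "gdist x y" arbitrary: x)
  case 0
  then show ?case by (metis gdist_eq_0_iff add.right_neutral of_nat_0 order_refl)
next
  case (Suc n)
  then obtain z where z: "adj x z" "gdist z y = n" using gdist_step by metis
  have "level z \<le> level x + 1" using level_other[OF z(1)] by (cases "z = parent x") auto
  with Suc(1)[of z] Suc(2) z show ?case by auto
qed

text \<open>A path of length n that climbs n levels must climb at every step, and the only neighbour one
level higher is the parent.\<close>
lemma below_imp_ancestor: "below x y \<Longrightarrow> (parent ^^ gdist x y) x = y"
proof (induction "gdist x y" arbitrary: x)
  case 0
  then show ?case by (metis funpow_0 gdist_eq_0_iff)
next
  case (Suc n)
  then obtain z where z: "adj x z" "gdist z y = n" using gdist_step by metis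
  have l: "level x = level y - int (Suc n)" using Suc unfolding below_def by simp
  have "level y \<le> level z + int n" using level_le_gdist[of y z] z by simp
  then have p: "z = parent x" using level_other[OF z(1)] l by force
  then have "below z y" unfolding below_def using z l by simp
  then have "(parent ^^ n) z = y" using Suc(1)[of z] z by simp
  then show ?case using p Suc(2) by (metis funpow_Suc_right comp_apply)
qed

lemma relpowp_parent: "(adj ^^ k) x ((parent ^^ k) x)"
  by (induction k) (auto intro: adj_parent)

lemma below_iff: "below x y \<and> level y - level x = int k \<longleftrightarrow> (parent ^^ k) x = y"
proof
  assume *: "below x y \<and> level y - level x = int k"
  then have "gdist x y = k" unfolding below_def by simp
  with * below_imp_ancestor show "(parent ^^ k) x = y" by blast
next
  assume *: "(parent ^^ k) x = y"
  then have l: "level y = level x + int k" using level_funpow_parent by blast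
  have "gdist x y \<le> k" using gdist_le[OF relpowp_parent] * by blast
  then show "below x y \<and> level y - level x = int k"
    unfolding below_def using l level_le_gdist[of y x] by auto
qed

section \<open>Masses of bands of descendants\<close>

definition weight :: "'v \<Rightarrow> real" where
  "weight x = real q powi level x"

definition mass :: "'v set \<Rightarrow> real" where
  "mass Q = sum weight Q"

definition band :: "'v \<Rightarrow> nat \<Rightarrow> nat \<Rightarrow> 'v set" where
  "band x a b = {y. \<exists>k. a \<le> k \<and> k < b \<and> (parent ^^ k) y = x}"

lemma q_pos [simp]: "0 < real q"
  using q_ge_2 by simp

lemma weight_pos [simp]: "0 < weight x"
  unfolding weight_def by (intro zero_less_power_int q_pos)

lemma weight_nonneg [simp]: "0 \<le> weight x"
  by (simp add: less_imp_le)

lemma weight_nonzero [simp]: "weight x \<noteq> 0"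
  using weight_pos[of x] by linarith

lemma weight_parent: "weight (parent y) = real q * weight y"
  unfolding weight_def level_parent using q_pos by (subst power_int_add) auto

lemma mass_pos: "finite Q \<Longrightarrow> Q \<noteq> {} \<Longrightarrow> 0 < mass Q"
  unfolding mass_def by (rule sum_pos) auto

text \<open>Mass is preserved from one generation to the next, because there are q children of 1/q of the
weight each.\<close>
lemma mass_children: "mass {y. parent y = x} = weight x"
proof -
  have "mass {y. parent y = x} = (\<Sum>y\<in>{y. parent y = x}. weight x / real q)"
    unfolding mass_def using weight_parent q_pos by (intro sum.cong) (auto simp: field_simps)
  then show ?thesis using card_children[of x] q_pos by simp
qed

lemma descendants_Suc:
  "{y. (parent ^^ Suc k) y = x} = (\<Union>z\<in>{z. (parent ^^ k) z = x}. {y. parent y = z})"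
  by (auto simp: funpow_Suc_right simp del: funpow.simps)

lemma finite_descendants: "finite {y. (parent ^^ k) y = x}"
  and mass_descendants: "mass {y. (parent ^^ k) y = x} = weight x"
proof (induction k)
  case 0
  show "finite {y. (parent ^^ 0) y = x}" "mass {y. (parent ^^ 0) y = x} = weight x"
    by (auto simp: mass_def)
next
  case (Suc k)
  show "finite {y. (parent ^^ Suc k) y = x}"
    unfolding descendants_Suc using Suc finite_children by blast
  have "mass {y. (parent ^^ Suc k) y = x} = (\<Sum>z\<in>{z. (parent ^^ k) z = x}. mass {y. parent y = z})"
    unfolding descendants_Suc mass_def
    by (rule sum.UNION_disjoint) (use Suc finite_children in auto)
  then show "mass {y. (parent ^^ Suc k) y = x} = weight x"
    using Suc(2) unfolding mass_children by (simp add: mass_def)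
qed

lemma band_eq_UN: "band x a b = (\<Union>k\<in>{a..<b}. {y. (parent ^^ k) y = x})"
  unfolding band_def by auto

lemma finite_band: "finite (band x a b)"
  unfolding band_eq_UN using finite_descendants by blast

lemma level_in_band: "(parent ^^ k) y = x \<Longrightarrow> level x - level y = int k"
  using level_funpow_parent[of k y] by auto

lemma mass_band: "mass (band x a b) = real (b - a) * weight x"
proof -
  have "mass (band x a b) = (\<Sum>k\<in>{a..<b}. mass {y. (parent ^^ k) y = x})"
    unfolding band_eq_UN mass_def
    by (rule sum.UNION_disjoint) (use finite_descendants level_in_band in \<open>fastforce+\<close>)
  then show ?thesis by (simp add: mass_descendants)
qed

lemma trapezoid_envelope_eq_band: "trapezoid_envelope x h = band x ((h + 1) div 2) (4 * h)"
proof -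
  have "y \<in> trapezoid_envelope x h \<longleftrightarrow> y \<in> band x ((h + 1) div 2) (4 * h)" for y
  proof
    assume y: "y \<in> trapezoid_envelope x h"
    define k where "k = gdist y x"
    have b: "below y x" using y unfolding trapezoid_envelope_def by simp
    then have k: "level x - level y = int k" unfolding below_def k_def by simp
    then have "(parent ^^ k) y = x" using b below_iff by blast
    moreover have "k < 4 * h" "real h / 2 \<le> real k"
      using y k unfolding trapezoid_envelope_def by auto
    moreover from this have "(h + 1) div 2 \<le> k" by linarith
    ultimately show "y \<in> band x ((h + 1) div 2) (4 * h)" unfolding band_def by blast
  next
    assume "y \<in> band x ((h + 1) div 2) (4 * h)"
    then obtain k where k: "(h + 1) div 2 \<le> k" "k < 4 * h" "(parent ^^ k) y = x"
      unfolding band_def by blast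
    have "below y x" "level x - level y = int k" using k(3) below_iff by blast+
    moreover have "real h / 2 \<le> real k" using k(1) by linarith
    ultimately show "y \<in> trapezoid_envelope x h"
      unfolding trapezoid_envelope_def using k(2) by simp
  qed
  then show ?thesis by blast
qed

lemma CZ_set_singleton: "CZ_set {x}"
  unfolding CZ_set_def is_envelope_of_def by blast

text \<open>This is the envelope of the trapezoid of height 2a; even heights make the inner depth h/2 an
integer.\<close>
lemma CZ_set_band: "1 \<le> a \<Longrightarrow> CZ_set (band x a (8 * a))"
  unfolding CZ_set_def is_envelope_of_def
  using trapezoid_envelope_eq_band[of x "2 * a"]
  by (intro exI[of _ "trapezoid x (2 * a)"] disjI2 exI[of _ x] exI[of _ "2 * a"]) simp

section \<open>Recursive partitions of bands\<close>

text \<open>A set is dyadic if it can be subdivided down to points, in such a way that masses drop by a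
bounded factor at each step and every intermediate set sits in a Calderon-Zygmund set of comparable
mass. The factor 2 q^2 is what the split of the lowest bands into points needs, and 7 is the mass
ratio of the bands with depths a <= k < 8a and a <= k < 2a.\<close>
inductive dyadic :: "'v set \<Rightarrow> bool" where
  point: "dyadic {x}"
| split: "\<lbrakk>finite P; disjoint P; \<forall>R\<in>P. dyadic R \<and> mass (\<Union>P) \<le> 2 * real q ^ 2 * mass R;
     CZ_set S; \<Union>P \<subseteq> S; finite S; mass S \<le> 7 * mass (\<Union>P); P \<noteq> {}\<rbrakk> \<Longrightarrow> dyadic (\<Union>P)"

lemma dyadic_finite_nonempty: "dyadic Q \<Longrightarrow> finite Q \<and> Q \<noteq> {}"
  by (induction rule: dyadic.induct) (auto intro: finite_subset)

lemma dyadic_container: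
  "dyadic Q \<Longrightarrow> \<exists>S. CZ_set S \<and> Q \<subseteq> S \<and> finite S \<and> mass S \<le> 7 * mass Q"
proof (induction rule: dyadic.induct)
  case (point x)
  have "mass {x} \<le> 7 * mass {x}" by (simp add: mass_def)
  then show ?case using CZ_set_singleton by (intro exI[of _ "{x}"]) auto
qed blast

lemma two_q_square: "8 \<le> 2 * real q ^ 2" "2 * real q \<le> 2 * real q ^ 2" "real q \<le> 2 * real q ^ 2"
proof -
  have q: "2 \<le> real q" using q_ge_2 by simp
  have "2 * 2 \<le> real q * real q" by (rule mult_mono) (use q in auto)
  then show "8 \<le> 2 * real q ^ 2" by (simp add: power2_eq_square)
  have "1 * real q \<le> real q * real q" by (rule mult_right_mono) (use q in auto)
  then show "2 * real q \<le> 2 * real q ^ 2" by (simp add: power2_eq_square)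
  then show "real q \<le> 2 * real q ^ 2" using q_pos by linarith
qed

lemma dyadic_band_split:
  assumes ab: "1 \<le> a" "2 * a \<le> b" "b \<le> 8 * a"
    and P: "finite P" "disjoint P" "\<Union>P = band x a b"
    and R: "\<And>R. R \<in> P \<Longrightarrow> dyadic R"
      "\<And>R. R \<in> P \<Longrightarrow> real (b - a) * weight x \<le> 2 * real q ^ 2 * mass R"
  shows "dyadic (band x a b)"
proof -
  let ?S = "band x a (8 * a)"
  have "real (8 * a - a) * weight x \<le> (7 * real (b - a)) * weight x"
    by (rule mult_right_mono) (use ab in auto)
  then have S: "mass ?S \<le> 7 * mass (\<Union>P)" unfolding P(3) mass_band by simp
  have "0 < mass (band x a b)" unfolding mass_band using ab by simp
  then have "P \<noteq> {}" using P(3) by (auto simp: mass_def)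
  moreover have "\<Union>P \<subseteq> ?S" using P(3) ab by (auto simp: band_def)
  moreover have "\<forall>R\<in>P. dyadic R \<and> mass (\<Union>P) \<le> 2 * real q ^ 2 * mass R"
    using R P(3) mass_band by simp
  ultimately have "dyadic (\<Union>P)"
    using P S CZ_set_band[OF ab(1)] finite_band by (intro dyadic.split[where S = ?S]) auto
  then show ?thesis using P(3) by simp
qed

text \<open>The condition 2a <= b <= 8a is kept by both ways of cutting. Cutting a tall band at 2a gives
[a,2a) and [2a,b) with 4a <= b <= 8a. If b < 4a and a >= 2, passing to the children gives
[a-1,b-1), where 2(a-1) <= b-1 and b-1 <= 4a-2 <= 8(a-1). For a = 1 the band has at most two
generations and is cut into points. Each cut decreases 2b - a.\<close>
lemma dyadic_band:
  assumes "1 \<le> a" "2 * a \<le> b" "b \<le> 8 * a"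
  shows "dyadic (band x a b)"
  using assms
proof (induction "2 * b - a" arbitrary: a b x rule: less_induct)
  case less
  note ab = less.prems
  have IH: "dyadic (band y c d)" if "1 \<le> c" "2 * c \<le> d" "d \<le> 8 * c" "2 * d - c < 2 * b - a" for y c d
    using less.hyps that by blast
  consider (tall) "4 * a \<le> b" | (wide) "b < 4 * a" "2 \<le> a" | (thin) "b < 4 * a" "a = 1"
    using ab by linarith
  then show ?case
  proof cases
    case tall
    let ?P = "{band x a (2 * a), band x (2 * a) b}"
    have "real (b - a) * weight x \<le> 2 * real q ^ 2 * mass R" if "R \<in> ?P" for R
    proof -
      have "real (b - a) \<le> 8 * real a" "real (b - a) \<le> 8 * real (b - 2 * a)"
        using ab tall by auto
      then have "real (b - a) * weight x \<le> 8 * mass R"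
        using that by (auto simp: mass_band simp flip: mult.assoc intro!: mult_right_mono)
      also have "\<dots> \<le> 2 * real q ^ 2 * mass R"
        by (rule mult_right_mono) (use two_q_square in \<open>auto simp: mass_def sum_nonneg\<close>)
      finally show ?thesis .
    qed
    moreover have "dyadic (band x a (2 * a))" "dyadic (band x (2 * a) b)"
      using ab tall by (auto intro!: IH)
    moreover have "band x a (2 * a) \<inter> band x (2 * a) b = {}"
      unfolding band_def using level_in_band by fastforce
    moreover have "band x a (2 * a) \<union> band x (2 * a) b = band x a b"
    proof -
      have "(a \<le> k \<and> k < 2 * a) \<or> (2 * a \<le> k \<and> k < b) \<longleftrightarrow> a \<le> k \<and> k < b" for k
        using tall ab by auto
      then show ?thesis unfolding band_def by blast
    qed
    ultimately show ?thesis
      using ab by (intro dyadic_band_split[where P = ?P]) (auto simp: disjoint_def Int_commute)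
  next
    case wide
    let ?B = "\<lambda>y. band y (a - 1) (b - 1)"
    let ?P = "?B ` {y. parent y = x}"
    have "\<Union>?P = band x a b"
    proof (intro equalityI subsetI)
      fix z assume "z \<in> \<Union>?P"
      then obtain k where "a - 1 \<le> k" "k < b - 1" "parent ((parent ^^ k) z) = x"
        unfolding band_def by auto
      then show "z \<in> band x a b" unfolding band_def by (intro CollectI exI[of _ "Suc k"]) auto
    next
      fix z assume "z \<in> band x a b"
      then obtain k where k: "a \<le> k" "k < b" "(parent ^^ k) z = x" unfolding band_def by auto
      then obtain l where l: "k = Suc l" using wide(2) by (cases k) auto
      then have "z \<in> ?B ((parent ^^ l) z)" 
        unfolding band_def using k l by (intro CollectI exI[of _ l]) auto
      moreover have "parent ((parent ^^ l) z) = x" using k l by simp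
      ultimately show "z \<in> \<Union>?P" by blast
    qed
    moreover have "y = y'" if "parent y = x" "parent y' = x" "z \<in> ?B y" "z \<in> ?B y'" for y y' z
    proof -
      obtain k k' where k: "(parent ^^ k) z = y" "(parent ^^ k') z = y'"
        using \<open>z \<in> ?B y\<close> \<open>z \<in> ?B y'\<close> unfolding band_def by blast
      have "level y = level y'" using \<open>parent y = x\<close> \<open>parent y' = x\<close> level_parent[of y] level_parent[of y'] by simp
      then have "k = k'" using k level_in_band by fastforce
      then show "y = y'" using k by simp
    qed
    then have "disjoint ?P" unfolding disjoint_def by blast
    moreover have "dyadic R" if "R \<in> ?P" for R
      using that wide ab by (auto intro!: IH)
    moreover have "real (b - a) * weight x \<le> 2 * real q ^ 2 * mass R" if "R \<in> ?P" for R
    proof -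
      have "\<exists>y. parent y = x \<and> R = ?B y" using that by blast
      then obtain y where y: "parent y = x" "R = ?B y" by blast
      have "mass R = real (b - a) * weight y" unfolding y(2) mass_band using wide by simp
      then have "real (b - a) * weight x = real q * mass R"
        using weight_parent[of y] y(1) by simp
      also have "\<dots> \<le> 2 * real q ^ 2 * mass R"
        by (rule mult_right_mono) (use two_q_square(3) in \<open>auto simp: mass_def sum_nonneg\<close>)
      finally show ?thesis .
    qed
    ultimately show ?thesis
      using ab finite_children by (intro dyadic_band_split[where P = ?P]) auto
  next
    case thin
    let ?P = "(\<lambda>y. {y}) ` band x a b"
    have "real (b - a) * weight x \<le> 2 * real q ^ 2 * mass R" if "R \<in> ?P" for R
    proof -
      have "\<exists>y. y \<in> band x a b \<and> R = {y}" using that by blast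
      then obtain y where y: "y \<in> band x a b" "R = {y}" by blast
      then obtain k where k: "a \<le> k" "k < b" "(parent ^^ k) y = x" unfolding band_def by blast
      then have "k = 1 \<or> k = 2" using thin by linarith
      then have "x = parent y \<or> x = parent (parent y)" using k(3) by (auto simp: numeral_2_eq_2)
      moreover have "real q * weight y \<le> real q ^ 2 * weight y"
        by (rule mult_right_mono) (use two_q_square(2) in auto)
      ultimately have "weight x \<le> real q ^ 2 * weight y"
        using weight_parent by (auto simp: power2_eq_square)
      moreover have "real (b - a) * weight x \<le> 2 * weight x"
        by (rule mult_right_mono) (use thin in auto)
      ultimately have "real (b - a) * weight x \<le> 2 * (real q ^ 2 * weight y)" by linarith
      then show ?thesis using y by (simp add: mass_def mult.assoc)
    qed
    then show ?thesis
      using ab finite_band by (intro dyadic_band_split[where P = ?P]) (auto simp: disjoint_def intro: dyadic.point)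
  qed
qed

lemma CZ_set_dyadic: assumes "CZ_set S" shows "dyadic S"
proof -
  consider x where "S = {x}" | x h where "1 \<le> h" "S = trapezoid_envelope x h"
    using assms unfolding CZ_set_def is_envelope_of_def by auto
  then show ?thesis
  proof cases
    case 1
    then show ?thesis by (simp add: dyadic.point)
  next
    case 2
    show ?thesis unfolding 2(2) trapezoid_envelope_eq_band
      by (rule dyadic_band) (use 2(1) in linarith)+
  qed
qed

section \<open>Atoms in terms of weighted sums\<close>

lemma measurable_mu [measurable, simp]: "f \<in> borel_measurable mu"
  unfolding mu_def by simp

lemma AE_mu_iff: "(AE x in mu. P x) \<longleftrightarrow> (\<forall>x. P x)"
  using weight_pos unfolding mu_def AE_point_measure weight_def by simp

lemma measure_mu: assumes "finite S" shows "measure mu S = mass S"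
proof -
  have "emeasure mu S = (\<Sum>x\<in>S. ennreal (weight x))"
    unfolding mu_def weight_def using assms by (intro emeasure_point_measure_finite2) auto
  then have "emeasure mu S = ennreal (mass S)"
    unfolding mass_def by simp
  then show ?thesis unfolding measure_def by (simp add: mass_def sum_nonneg)
qed

lemma nn_integral_mu:
  assumes "finite S" "\<And>x. x \<notin> S \<Longrightarrow> f x = 0"
  shows "(\<integral>\<^sup>+x. f x \<partial>mu) = (\<Sum>x\<in>S. ennreal (weight x) * f x)"
  unfolding mu_def point_measure_def weight_def
  by (subst nn_integral_density) (use assms in \<open>auto intro!: nn_integral_count_space'\<close>)

lemma integral_mu:
  fixes f :: "'v \<Rightarrow> complex"
  assumes "finite S" "\<And>x. x \<notin> S \<Longrightarrow> f x = 0"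
  shows "(\<integral>x. f x \<partial>mu) = (\<Sum>x\<in>S. of_real (weight x) * f x)"
proof -
  have "(\<integral>x. f x \<partial>mu) = (\<integral>x. weight x *\<^sub>R f x \<partial>count_space UNIV)"
    unfolding mu_def point_measure_def weight_def
    by (rule integral_density) (auto simp: AE_count_space simp flip: weight_def)
  also have "\<dots> = (\<Sum>x | weight x *\<^sub>R f x \<noteq> 0. weight x *\<^sub>R f x)"
    using finite_subset[OF _ assms(1), of "{x. weight x *\<^sub>R f x \<noteq> 0}"] assms(2)
    by (subst lebesgue_integral_count_space_finite_support) auto
  also have "\<dots> = (\<Sum>x\<in>S. weight x *\<^sub>R f x)"
    by (rule sum.mono_neutral_left) (use assms in auto)
  finally show ?thesis by (simp add: scaleR_conv_of_real)
qed

lemma CZ_set_finite: "CZ_set S \<Longrightarrow> finite S" and CZ_set_nonempty: "CZ_set S \<Longrightarrow> S \<noteq> {}"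
  using CZ_set_dyadic dyadic_finite_nonempty by blast+

lemma CZ_set_mass_pos: "CZ_set S \<Longrightarrow> 0 < mass S"
  by (simp add: mass_pos CZ_set_finite CZ_set_nonempty)

lemma Lp_norm_infinity_le_iff: "Lp_norm \<infinity> f \<le> ereal c \<longleftrightarrow> (\<forall>x. cmod (f x) \<le> c)"
proof
  assume *: "Lp_norm \<infinity> f \<le> ereal c"
  have "AE x in mu. ereal (cmod (f x)) \<le> esssup mu (\<lambda>x. ereal (cmod (f x)))"
    by (rule esssup_AE)
  then have "ereal (cmod (f x)) \<le> Lp_norm \<infinity> f" for x
    unfolding AE_mu_iff Lp_norm_def by simp
  then show "\<forall>x. cmod (f x) \<le> c" using * by (meson ereal_less_eq(3) order_trans)
qed (auto simp: Lp_norm_def AE_mu_iff)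

lemma Lp_norm_finite_support:
  assumes "finite S" "\<And>x. x \<notin> S \<Longrightarrow> f x = 0"
  shows "Lp_norm (ereal p) f = ereal ((\<Sum>x\<in>S. weight x * cmod (f x) powr p) powr (1 / p))"
proof -
  have "(\<integral>\<^sup>+x. ennreal (cmod (f x) powr p) \<partial>mu)
      = (\<Sum>x\<in>S. ennreal (weight x) * ennreal (cmod (f x) powr p))"
    using assms by (intro nn_integral_mu) auto
  also have "\<dots> = ennreal (\<Sum>x\<in>S. weight x * cmod (f x) powr p)"
    by (simp flip: ennreal_mult)
  finally show ?thesis unfolding Lp_norm_def by (simp add: sum_nonneg)
qed

lemma integral_mu_CZ_set:
  fixes a :: "'v \<Rightarrow> complex"
  assumes "CZ_set S" "\<forall>x. a x \<noteq> 0 \<longrightarrow> x \<in> S"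
  shows "(\<integral>x. a x \<partial>mu) = (\<Sum>x\<in>S. of_real (weight x) * a x)"
  using assms CZ_set_finite by (intro integral_mu) auto

lemma atom_infinity_iff:
  "atom \<infinity> a \<longleftrightarrow> (\<exists>S. CZ_set S \<and> (\<forall>x. a x \<noteq> 0 \<longrightarrow> x \<in> S) \<and> (\<forall>x. cmod (a x) \<le> 1 / mass S)
      \<and> (\<Sum>x\<in>S. of_real (weight x) * a x) = 0)"
proof -
  have "Lp_norm \<infinity> a \<le> ereal (measure mu S powr (real_of_ereal (1 / \<infinity>) - 1)) \<longleftrightarrow>
      (\<forall>x. cmod (a x) \<le> 1 / mass S)" if "CZ_set S" for S
    unfolding measure_mu[OF CZ_set_finite[OF that]]
    using Lp_norm_infinity_le_iff CZ_set_mass_pos[OF that] by (simp add: powr_minus_divide)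
  then have "CZ_set S \<and> (\<forall>x. a x \<noteq> 0 \<longrightarrow> x \<in> S) \<and> (\<forall>x. cmod (a x) \<le> 1 / mass S)
      \<and> (\<Sum>x\<in>S. of_real (weight x) * a x) = 0 \<longleftrightarrow>
    (CZ_set S \<and> (\<forall>x. a x \<noteq> 0 \<longrightarrow> x \<in> S) \<and>
      Lp_norm \<infinity> a \<le> ereal (measure mu S powr (real_of_ereal (1 / \<infinity>) - 1)))
      \<and> (\<integral>x. a x \<partial>mu) = 0" for S
    using integral_mu_CZ_set[of S a] by (cases "CZ_set S \<and> (\<forall>x. a x \<noteq> 0 \<longrightarrow> x \<in> S)") auto
  then show ?thesis unfolding atom_def by auto
qed

lemma atom_ereal_iff:
  assumes "0 < p"
  shows "atom (ereal p) a \<longleftrightarrow> (\<exists>S. CZ_set S \<and> (\<forall>x. a x \<noteq> 0 \<longrightarrow> x \<in> S) \<and>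
      (\<Sum>x\<in>S. weight x * cmod (a x) powr p) powr (1 / p) \<le> mass S powr (1 / p - 1)
      \<and> (\<Sum>x\<in>S. of_real (weight x) * a x) = 0)"
proof -
  have "Lp_norm (ereal p) a \<le> ereal (measure mu S powr (real_of_ereal (1 / ereal p) - 1)) \<longleftrightarrow>
      (\<Sum>x\<in>S. weight x * cmod (a x) powr p) powr (1 / p) \<le> mass S powr (1 / p - 1)"
    if S: "CZ_set S" "\<forall>x. a x \<noteq> 0 \<longrightarrow> x \<in> S" for S
  proof -
    have "real_of_ereal (1 / ereal p) = 1 / p" using assms by (simp add: one_ereal_def)
    moreover have "Lp_norm (ereal p) a
        = ereal ((\<Sum>x\<in>S. weight x * cmod (a x) powr p) powr (1 / p))"
      by (rule Lp_norm_finite_support) (use S CZ_set_finite in auto)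
    ultimately show ?thesis using measure_mu[OF CZ_set_finite[OF S(1)]] by simp
  qed
  then have "CZ_set S \<and> (\<forall>x. a x \<noteq> 0 \<longrightarrow> x \<in> S) \<and>
      (\<Sum>x\<in>S. weight x * cmod (a x) powr p) powr (1 / p) \<le> mass S powr (1 / p - 1)
      \<and> (\<Sum>x\<in>S. of_real (weight x) * a x) = 0 \<longleftrightarrow>
    (CZ_set S \<and> (\<forall>x. a x \<noteq> 0 \<longrightarrow> x \<in> S) \<and>
      Lp_norm (ereal p) a \<le> ereal (measure mu S powr (real_of_ereal (1 / ereal p) - 1)))
      \<and> (\<integral>x. a x \<partial>mu) = 0" for S
    using integral_mu_CZ_set[of S a] by (cases "CZ_set S \<and> (\<forall>x. a x \<noteq> 0 \<longrightarrow> x \<in> S)") auto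
  then show ?thesis unfolding atom_def by auto
qed

text \<open>The bound 1/mu(S) on S gives the L^p norm at most mu(S)^(1/p) / mu(S).\<close>
lemma atom_infinity_imp_atom:
  assumes "atom \<infinity> a" "0 < p"
  shows "atom (ereal p) a"
proof -
  obtain S where S: "CZ_set S" "\<forall>x. a x \<noteq> 0 \<longrightarrow> x \<in> S" "\<And>x. cmod (a x) \<le> 1 / mass S"
      "(\<Sum>x\<in>S. of_real (weight x) * a x) = 0"
    using assms(1) unfolding atom_infinity_iff by blast
  note m = CZ_set_mass_pos[OF S(1)]
  have "(\<Sum>x\<in>S. weight x * cmod (a x) powr p) \<le> (\<Sum>x\<in>S. weight x * (1 / mass S) powr p)"
    by (intro sum_mono mult_left_mono powr_mono2) (use assms S(3) in auto)
  also have "\<dots> = mass S * (1 / mass S) powr p"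
    by (simp add: mass_def sum_distrib_right)
  finally have "(\<Sum>x\<in>S. weight x * cmod (a x) powr p) powr (1 / p)
      \<le> (mass S * (1 / mass S) powr p) powr (1 / p)"
    using assms(2) by (intro powr_mono2) (auto intro: sum_nonneg)
  also have "\<dots> = mass S powr (1 / p) * (1 / mass S)"
    using m assms(2) by (simp add: powr_mult powr_powr)
  also have "\<dots> = mass S powr (1 / p - 1)" using m by (simp add: powr_diff)
  finally show ?thesis using S assms(2) atom_ereal_iff by blast
qed

text \<open>K bounds the cost of writing f as a finite combination of (1,infinity)-atoms. Lists make such
combinations concatenable without reindexing.\<close>
definition finite_atomic :: "('v \<Rightarrow> complex) \<Rightarrow> real \<Rightarrow> bool" where
  "finite_atomic f K \<longleftrightarrow> (\<exists>xs. (\<forall>(c, a)\<in>set xs. atom \<infinity> a) \<and>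
     (\<forall>x. f x = (\<Sum>(c, a)\<leftarrow>xs. c * a x)) \<and> (\<Sum>(c, a)\<leftarrow>xs. cmod c) \<le> K)"

lemma finite_atomic_zero: "0 \<le> K \<Longrightarrow> finite_atomic (\<lambda>x. 0) K"
  unfolding finite_atomic_def by (rule exI[of _ "[]"]) simp

lemma finite_atomic_add:
  assumes "finite_atomic f K" "finite_atomic f' L"
  shows "finite_atomic (\<lambda>x. f x + f' x) (K + L)"
proof -
  obtain xs ys where "\<forall>(c, a)\<in>set xs. atom \<infinity> a" "\<forall>x. f x = (\<Sum>(c, a)\<leftarrow>xs. c * a x)"
      "(\<Sum>(c, a)\<leftarrow>xs. cmod c) \<le> K" "\<forall>(c, a)\<in>set ys. atom \<infinity> a"
      "\<forall>x. f' x = (\<Sum>(c, a)\<leftarrow>ys. c * a x)" "(\<Sum>(c, a)\<leftarrow>ys. cmod c) \<le> L"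
    using assms unfolding finite_atomic_def by blast
  then show ?thesis unfolding finite_atomic_def by (intro exI[of _ "xs @ ys"]) auto
qed

lemma finite_atomic_sum:
  assumes "finite F" "\<And>R. R \<in> F \<Longrightarrow> finite_atomic (f R) (K R)"
  shows "finite_atomic (\<lambda>x. \<Sum>R\<in>F. f R x) (\<Sum>R\<in>F. K R)"
  using assms by (induction F rule: finite_induct) (auto intro: finite_atomic_zero finite_atomic_add)

lemma finite_atomic_mono: "finite_atomic f K \<Longrightarrow> K \<le> L \<Longrightarrow> finite_atomic f L"
  unfolding finite_atomic_def by (meson order_trans)

text \<open>f is a multiple of one atom on a Calderon-Zygmund set containing Q; the factor 7 bounds the mass
of that set by the mass of Q.\<close>
lemma finite_atomic_bounded:
  assumes "dyadic Q" "\<And>x. x \<notin> Q \<Longrightarrow> f x = 0" "\<And>x. cmod (f x) \<le> t" "0 < t"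
    and mean: "(\<Sum>x\<in>Q. of_real (weight x) * f x) = 0"
  shows "finite_atomic f (7 * t * mass Q)"
proof -
  obtain S where S: "CZ_set S" "Q \<subseteq> S" "finite S" "mass S \<le> 7 * mass Q"
    using dyadic_container assms(1) by blast
  note m = CZ_set_mass_pos[OF S(1)]
  define a where "a x = f x / of_real (t * mass S)" for x
  have "(\<Sum>x\<in>S. of_real (weight x) * f x) = 0"
    unfolding mean[symmetric] by (rule sum.mono_neutral_right) (use S assms in auto)
  then have "(\<Sum>x\<in>S. of_real (weight x) * a x) = 0"
    unfolding a_def by (simp flip: sum_divide_distrib)
  moreover have "cmod (a x) \<le> 1 / mass S" for x
    using assms(3)[of x] assms(4) m unfolding a_def by (simp add: norm_divide norm_mult divide_simps)
  moreover have "\<forall>x. a x \<noteq> 0 \<longrightarrow> x \<in> S" using assms(2) S(2) unfolding a_def by auto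
  ultimately have "atom \<infinity> a" using S(1) unfolding atom_infinity_iff by blast
  moreover have "f x = of_real (t * mass S) * a x" for x using m assms(4) unfolding a_def by simp
  moreover have "cmod (of_real (t * mass S)) \<le> 7 * t * mass Q"
    using S(4) m assms(4) by (simp add: norm_mult mult.commute mult.left_commute)
  ultimately show ?thesis
    unfolding finite_atomic_def by (intro exI[of _ "[(of_real (t * mass S), a)]"]) auto
qed

section \<open>Calderon-Zygmund decomposition of an atom\<close>

definition average :: "('v \<Rightarrow> complex) \<Rightarrow> 'v set \<Rightarrow> complex" where
  "average f Q = (\<Sum>x\<in>Q. of_real (weight x) * f x) / of_real (mass Q)"

definition oscillation :: "('v \<Rightarrow> complex) \<Rightarrow> 'v set \<Rightarrow> 'v \<Rightarrow> complex" where
  "oscillation f Q x = (if x \<in> Q then f x - average f Q else 0)"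

definition energy :: "real \<Rightarrow> ('v \<Rightarrow> complex) \<Rightarrow> 'v set \<Rightarrow> real" where
  "energy p f Q = (\<Sum>x\<in>Q. weight x * cmod (f x) powr p)"

definition pmean :: "real \<Rightarrow> ('v \<Rightarrow> complex) \<Rightarrow> 'v set \<Rightarrow> real" where
  "pmean p f Q = (energy p f Q / mass Q) powr (1 / p)"

lemma energy_nonneg: "0 \<le> energy p f Q"
  unfolding energy_def by (auto intro: sum_nonneg)

lemma energy_mono: "finite Q \<Longrightarrow> R \<subseteq> Q \<Longrightarrow> energy p f R \<le> energy p f Q"
  unfolding energy_def by (rule sum_mono2) auto

lemma energy_disjoint_Union:
  assumes "finite Q" "disjoint F" "\<Union>F \<subseteq> Q"
  shows "(\<Sum>R\<in>F. energy p f R) \<le> energy p f Q"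
proof -
  have "\<forall>R\<in>F. finite R" using assms by (meson Sup_upper finite_subset)
  then have "(\<Sum>R\<in>F. energy p f R) = energy p f (\<Union>F)"
    unfolding energy_def using assms(2)
    by (subst sum.Union_disjoint) (auto simp: disjoint_def)
  then show ?thesis using energy_mono assms by simp
qed

lemma pmean_nonneg [simp]: "0 \<le> pmean p f Q"
  unfolding pmean_def by simp

lemma pmean_powr:
  assumes "0 < p" "finite Q" "Q \<noteq> {}"
  shows "pmean p f Q powr p * mass Q = energy p f Q"
  using assms energy_nonneg mass_pos[OF assms(2,3)] unfolding pmean_def by (simp add: powr_powr)

lemma pmean_singleton: "0 < p \<Longrightarrow> pmean p f {x} = cmod (f x)"
  using weight_pos[of x] unfolding pmean_def energy_def mass_def by (simp add: powr_powr)

lemma pmean_subset: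
  assumes "1 \<le> p" "finite Q" "R \<subseteq> Q" "R \<noteq> {}" "mass Q \<le> K * mass R" "1 \<le> K"
  shows "pmean p f R \<le> K * pmean p f Q"
proof -
  have m: "0 < mass R" "0 < mass Q" using assms by (auto intro!: mass_pos intro: finite_subset)
  have "energy p f R / mass R \<le> energy p f Q / (mass Q / K)"
    using m assms energy_nonneg energy_mono by (intro frac_le) (auto simp: field_simps)
  then have "pmean p f R \<le> (K * (energy p f Q / mass Q)) powr (1 / p)"
    unfolding pmean_def using assms m energy_nonneg
    by (intro powr_mono2) (auto simp: field_simps)
  also have "\<dots> = K powr (1 / p) * pmean p f Q"
    unfolding pmean_def using assms m energy_nonneg by (intro powr_mult)
  also have "K powr (1 / p) \<le> K powr 1" using assms by (intro powr_mono) auto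
  finally show ?thesis using assms by (simp add: mult_right_mono)
qed

lemma energy_eq_0: "\<lbrakk>energy p f Q = 0; finite Q; x \<in> Q\<rbrakk> \<Longrightarrow> f x = 0"
  unfolding energy_def using weight_pos[of x] by (auto simp: sum_nonneg_eq_0_iff)

text \<open>Jensen's inequality up to the factor 2, from the pointwise bound
s <= A + s^p A^(1-p) for s >= 0: either s <= A, or the factor (s/A)^(p-1) is at least 1.\<close>
lemma norm_average_le:
  assumes "1 \<le> p" "finite Q" "Q \<noteq> {}"
  shows "cmod (average f Q) \<le> 2 * pmean p f Q"
proof (cases "energy p f Q = 0")
  case True
  then have "(\<Sum>x\<in>Q. of_real (weight x) * f x) = 0"
    using energy_eq_0 assms(2) by (intro sum.neutral) auto
  then have "average f Q = 0" unfolding average_def by simp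
  then show ?thesis by simp
next
  case False
  note m = mass_pos[OF assms(2,3)]
  let ?A = "pmean p f Q"
  have "0 < energy p f Q" using False energy_nonneg[of p f Q] by simp
  then have A: "0 < ?A" using m unfolding pmean_def by simp
  \<comment> \<open>for s > A, write s = s^p s^(1-p) and use that the exponent 1 - p is not positive\<close>
  have pt: "s \<le> ?A + s powr p * ?A powr (1 - p)" if "0 \<le> s" for s :: real
  proof (cases "s \<le> ?A")
    case False
    then have s: "0 < s" "?A \<le> s" using A by auto
    have "s = s powr p * s powr (1 - p)" using s by (simp flip: powr_add)
    also have "\<dots> \<le> s powr p * ?A powr (1 - p)"
      using s A assms by (intro mult_left_mono powr_mono2') auto
    finally show ?thesis using A by simp
  qed (simp add: add_increasing2)
  have "cmod (\<Sum>x\<in>Q. of_real (weight x) * f x) \<le> (\<Sum>x\<in>Q. weight x * cmod (f x))"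
    by (rule sum_norm_le) (simp add: norm_mult)
  also have "\<dots> \<le> (\<Sum>x\<in>Q. weight x * (?A + cmod (f x) powr p * ?A powr (1 - p)))"
    by (intro sum_mono mult_left_mono pt) auto
  also have "\<dots> = ?A * mass Q + energy p f Q * ?A powr (1 - p)"
    unfolding mass_def energy_def
    by (simp add: algebra_simps sum.distrib sum_distrib_left sum_distrib_right)
  also have "energy p f Q * ?A powr (1 - p) = ?A powr p * ?A powr (1 - p) * mass Q"
    using assms by (simp flip: pmean_powr)
  also have "?A powr p * ?A powr (1 - p) = ?A" using A by (simp flip: powr_add)
  finally show ?thesis using m unfolding average_def by (simp add: norm_divide field_simps)
qed

lemma sum_oscillation:
  assumes "finite Q" "Q \<noteq> {}"
  shows "(\<Sum>x\<in>Q. of_real (weight x) * oscillation f Q x) = 0"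
proof -
  have "(\<Sum>x\<in>Q. of_real (weight x) * oscillation f Q x)
      = (\<Sum>x\<in>Q. of_real (weight x) * f x) - (\<Sum>x\<in>Q. of_real (weight x)) * average f Q"
    by (simp add: oscillation_def right_diff_distrib sum_subtractf sum_distrib_right)
  also have "\<dots> = 0"
    using mass_pos[OF assms] unfolding average_def by (simp add: mass_def flip: of_real_sum)
  finally show ?thesis .
qed

text \<open>F consists of the maximal pieces of the subdivision on which the mean exceeds t. The piece
just above a stopping piece has mean at most t, so the mean on the stopping piece is at most t times
the mass ratio; a point at which no piece stops is itself a piece of the subdivision, with mean
equal to the modulus of f there.\<close>
lemma stopping_family:
  assumes "dyadic Q" "1 \<le> p" "pmean p f Q \<le> t"
  shows "\<exists>F. finite F \<and> disjoint F \<and>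
    (\<forall>R\<in>F. dyadic R \<and> R \<subseteq> Q \<and> t < pmean p f R \<and> pmean p f R \<le> 2 * real q ^ 2 * t) \<and>
    (\<forall>x\<in>Q - \<Union>F. cmod (f x) \<le> t)"
  using assms(1,3)
proof (induction rule: dyadic.induct)
  case (point x)
  then show ?case using assms(2) by (intro exI[of _ "{}"]) (auto simp: pmean_singleton)
next
  case (split P S)
  let ?K = "2 * real q ^ 2"
  let ?good = "\<lambda>Q F. finite F \<and> disjoint F \<and>
    (\<forall>R\<in>F. dyadic R \<and> R \<subseteq> Q \<and> t < pmean p f R \<and> pmean p f R \<le> ?K * t) \<and>
    (\<forall>x\<in>Q - \<Union>F. cmod (f x) \<le> t)"
  have "\<exists>F. ?good R F" if R: "R \<in> P" for R
  proof (cases "pmean p f R \<le> t")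
    case True
    then show ?thesis using split.IH R by blast
  next
    case False
    have d: "dyadic R" using split R by blast
    have "finite (\<Union>P)" using split.hyps finite_subset by blast
    moreover have "mass (\<Union>P) \<le> ?K * mass R" "R \<subseteq> \<Union>P" "R \<noteq> {}" "1 \<le> ?K"
      using split.IH R two_q_square(1) dyadic_finite_nonempty[OF d] by auto
    ultimately have "pmean p f R \<le> ?K * pmean p f (\<Union>P)"
      using assms(2) by (intro pmean_subset) auto
    also have "\<dots> \<le> ?K * t" using split.prems by (intro mult_left_mono) auto
    finally show ?thesis using d False by (intro exI[of _ "{R}"]) auto
  qed
  then obtain G where G: "\<And>R. R \<in> P \<Longrightarrow> ?good R (G R)" by metis
  have "disjoint (\<Union>(G ` P))"
  proof (rule disjointI)
    fix A B assume AB: "A \<in> \<Union>(G ` P)" "B \<in> \<Union>(G ` P)" "A \<noteq> B"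
    then obtain R R' where R: "R \<in> P" "A \<in> G R" "R' \<in> P" "B \<in> G R'" by blast
    show "A \<inter> B = {}"
    proof (cases "R = R'")
      case True
      then show ?thesis using G[OF R(1)] R AB(3) by (auto dest: disjointD)
    next
      case False
      then have "R \<inter> R' = {}" using split.hyps R by (auto dest: disjointD)
      moreover have "A \<subseteq> R" "B \<subseteq> R'" using G R by blast+
      ultimately show ?thesis by blast
    qed
  qed
  moreover have "finite (\<Union>(G ` P))" using G split.hyps(1) by blast
  moreover have "\<forall>R\<in>\<Union>(G ` P). dyadic R \<and> R \<subseteq> \<Union>P \<and> t < pmean p f R \<and> pmean p f R \<le> ?K * t"
    using G by blast
  moreover have "cmod (f x) \<le> t" if "x \<in> \<Union>P - \<Union>(\<Union>(G ` P))" for x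
  proof -
    have "\<exists>R\<in>P. x \<in> R - \<Union>(G R)" using that by blast
    then obtain R where "R \<in> P" "x \<in> R - \<Union>(G R)" by (elim bexE)
    then show ?thesis using G by blast
  qed
  ultimately show ?case by (intro exI[of _ "\<Union>(G ` P)"] conjI ballI) auto
qed

lemma oscillation_family:
  assumes "finite F" "disjoint F" "x \<in> R" "R \<in> F"
  shows "(\<Sum>R\<in>F. oscillation f R x) = f x - average f R"
proof -
  have "(\<Sum>R\<in>F. oscillation f R x) = (\<Sum>R\<in>{R}. oscillation f R x)"
    using assms by (intro sum.mono_neutral_right) (auto simp: oscillation_def disjoint_def)
  then show ?thesis using assms by (simp add: oscillation_def)
qed

text \<open>On a stopping piece the difference of oscillations is a difference of two averages; elsewhere
it involves values of f below the threshold. The constant is 8 + 2 in units of q^2 A(Q).\<close>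
lemma stopped_part_bounded:
  assumes "dyadic Q" "1 \<le> p" "0 < pmean p f Q" "finite F" "disjoint F"
    "\<And>R. R \<in> F \<Longrightarrow> dyadic R \<and> R \<subseteq> Q \<and> pmean p f R \<le> 2 * real q ^ 2 * (2 * pmean p f Q)"
    "\<And>x. x \<in> Q - \<Union>F \<Longrightarrow> cmod (f x) \<le> 2 * pmean p f Q"
  shows "cmod (oscillation f Q x - (\<Sum>R\<in>F. oscillation f R x)) \<le> 10 * real q ^ 2 * pmean p f Q"
proof -
  let ?A = "pmean p f Q" and ?Kq = "real q ^ 2"
  have K: "4 * ?A \<le> ?Kq * ?A" by (rule mult_right_mono) (use two_q_square in auto)
  have avg: "cmod (average f Q) \<le> 2 * ?A"
    using norm_average_le assms(1,2) dyadic_finite_nonempty by blast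
  consider (in_F) R where "R \<in> F" "x \<in> R" | (off_F) "x \<in> Q - \<Union>F" | (out) "x \<notin> Q"
    using assms(6) by blast
  then show ?thesis
  proof cases
    case in_F
    then have x: "x \<in> Q" and d: "finite R" "R \<noteq> {}"
      using assms(6) dyadic_finite_nonempty by blast+
    have eq: "oscillation f Q x - (\<Sum>R\<in>F. oscillation f R x) = average f R - average f Q"
      using oscillation_family[OF assms(4,5) in_F(2,1)] x by (simp add: oscillation_def)
    have "cmod (average f R) \<le> 8 * (?Kq * ?A)"
      using norm_average_le[OF assms(2) d, of f] assms(6)[OF in_F(1)] by linarith
    then show ?thesis unfolding eq mult.assoc
      using norm_triangle_ineq4[of "average f R" "average f Q"] avg K assms(3) by linarith
  next
    case off_F
    then have "(\<Sum>R\<in>F. oscillation f R x) = 0" by (auto simp: oscillation_def intro!: sum.neutral)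
    then have eq: "oscillation f Q x - (\<Sum>R\<in>F. oscillation f R x) = f x - average f Q"
      using off_F by (simp add: oscillation_def)
    show ?thesis unfolding eq mult.assoc
      using norm_triangle_ineq4[of "f x" "average f Q"] avg K assms(7)[OF off_F] assms(3)
      by linarith
  next
    case out
    then have "x \<notin> R" if "R \<in> F" for R using assms(6)[OF that] by blast
    then have "(\<Sum>R\<in>F. oscillation f R x) = 0"
      by (intro sum.neutral) (simp add: oscillation_def)
    then show ?thesis using out assms(3) by (simp add: oscillation_def)
  qed
qed

text \<open>The gain over the trivial bound: on the stopping pieces the mean exceeds the threshold, so
A(R) <= A(R)^p (2 A(Q))^(1-p), and A(R)^p mu(R) is the energy of f on R, which is additive.\<close>
lemma stopped_mass:
  assumes "finite Q" "Q \<noteq> {}" "1 < p" "0 < pmean p f Q" "finite F" "disjoint F"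
    "\<And>R. R \<in> F \<Longrightarrow> finite R \<and> R \<noteq> {} \<and> R \<subseteq> Q \<and> 2 * pmean p f Q < pmean p f R"
  shows "(\<Sum>R\<in>F. pmean p f R * mass R) \<le> 2 powr (1 - p) * (pmean p f Q * mass Q)"
proof -
  let ?A = "pmean p f Q"
  have "pmean p f R * mass R \<le> (2 * ?A) powr (1 - p) * energy p f R" if "R \<in> F" for R
  proof -
    note R = assms(7)[OF that]
    let ?B = "pmean p f R"
    have B: "0 < ?B" using R assms(4) by simp
    have "?B = ?B powr (1 - p) * ?B powr p" using B by (simp flip: powr_add)
    also have "\<dots> \<le> (2 * ?A) powr (1 - p) * ?B powr p"
      using R assms B by (intro mult_right_mono powr_mono2') auto
    finally have "?B * mass R \<le> (2 * ?A) powr (1 - p) * ?B powr p * mass R"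
      using R by (intro mult_right_mono) (auto simp: mass_pos less_imp_le)
    then show ?thesis using R assms(3) by (simp add: pmean_powr mult.assoc)
  qed
  then have "(\<Sum>R\<in>F. pmean p f R * mass R) \<le> (\<Sum>R\<in>F. (2 * ?A) powr (1 - p) * energy p f R)"
    by (rule sum_mono)
  also have "\<dots> = (2 * ?A) powr (1 - p) * (\<Sum>R\<in>F. energy p f R)" by (simp add: sum_distrib_left)
  also have "\<dots> \<le> (2 * ?A) powr (1 - p) * energy p f Q"
    using assms by (intro mult_left_mono energy_disjoint_Union) auto
  also have "\<dots> = 2 powr (1 - p) * (?A powr (1 - p) * ?A powr p) * mass Q"
    using assms by (simp add: powr_mult flip: pmean_powr)
  also have "?A powr (1 - p) * ?A powr p = ?A" using assms(4) by (simp flip: powr_add)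
  finally show ?thesis by (simp add: mult.assoc)
qed

text \<open>The sum of the geometric series with ratio 2^(1-p), whose first term 70 q^2 is the cost
7 * 10 q^2 of the bounded remainder.\<close>
definition CZ_const :: "real \<Rightarrow> real" where
  "CZ_const p = 70 * real q ^ 2 / (1 - 2 powr (1 - p))"

lemma CZ_const:
  assumes "1 < p"
  shows "0 < CZ_const p" "70 * real q ^ 2 + CZ_const p * 2 powr (1 - p) = CZ_const p"
proof -
  have "2 powr (1 - p) < 2 powr (0::real)" using assms by (intro powr_less_mono) auto
  then have r: "(2::real) powr (1 - p) < 1" by simp
  have geometric: "K + K / (1 - r) * r = K / (1 - r)" if "r < 1" for K r :: real
  proof -
    have "1 - r \<noteq> 0" using that by simp
    then show ?thesis by (simp add: divide_simps) (simp add: algebra_simps)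
  qed
  show "0 < CZ_const p" using r unfolding CZ_const_def using q_pos by simp
  show "70 * real q ^ 2 + CZ_const p * 2 powr (1 - p) = CZ_const p"
    unfolding CZ_const_def by (rule geometric[OF r])
qed

text \<open>The stopping pieces are proper subsets of Q, as their mean is larger than that of Q, so the
induction is on the cardinality.\<close>
lemma oscillation_atomic:
  assumes "1 < p" "dyadic Q"
  shows "finite_atomic (oscillation f Q) (CZ_const p * (pmean p f Q * mass Q))"
  using assms(2)
proof (induction "card Q" arbitrary: Q rule: less_induct)
  case less
  have Q: "finite Q" "Q \<noteq> {}" using less.prems dyadic_finite_nonempty by blast+
  note m = mass_pos[OF Q]
  let ?A = "pmean p f Q" and ?r = "2 powr (1 - p)" and ?C = "CZ_const p"
  show ?case
  proof (cases "energy p f Q = 0")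
    case True
    then have "f x = 0" if "x \<in> Q" for x using energy_eq_0 Q that by blast
    then have "oscillation f Q = (\<lambda>x. 0)" by (auto simp: oscillation_def average_def)
    then show ?thesis using CZ_const(1)[OF assms(1)] m by (simp add: finite_atomic_zero)
  next
    case False
    have "0 < energy p f Q" using False energy_nonneg[of p f Q] by simp
    then have A: "0 < ?A" using m unfolding pmean_def by simp
    obtain F where F: "finite F" "disjoint F" "\<And>R. R \<in> F \<Longrightarrow> dyadic R \<and> R \<subseteq> Q \<and>
          2 * ?A < pmean p f R \<and> pmean p f R \<le> 2 * real q ^ 2 * (2 * ?A)"
        "\<And>x. x \<in> Q - \<Union>F \<Longrightarrow> cmod (f x) \<le> 2 * ?A"
      using stopping_family[OF less.prems, of p f "2 * ?A"] assms A by auto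
    have FQ: "finite R" "R \<noteq> {}" "R \<subseteq> Q" if "R \<in> F" for R
      using F(3)[OF that] dyadic_finite_nonempty by blast+
    \<comment> \<open>the bounded part; its mean is zero because every oscillation has mean zero\<close>
    define b where "b x = oscillation f Q x - (\<Sum>R\<in>F. oscillation f R x)" for x
    have "(\<Sum>x\<in>Q. of_real (weight x) * oscillation f R x) = 0" if "R \<in> F" for R
    proof -
      have "(\<Sum>x\<in>Q. of_real (weight x) * oscillation f R x)
          = (\<Sum>x\<in>R. of_real (weight x) * oscillation f R x)"
        using FQ[OF that] Q by (intro sum.mono_neutral_right) (auto simp: oscillation_def)
      then show ?thesis using sum_oscillation FQ[OF that] by simp
    qed
    then have "(\<Sum>x\<in>Q. of_real (weight x) * (\<Sum>R\<in>F. oscillation f R x)) = 0"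
      by (simp add: sum_distrib_left sum.swap[of _ F Q])
    then have "(\<Sum>x\<in>Q. of_real (weight x) * b x) = 0"
      using sum_oscillation[OF Q, of f] unfolding b_def
      by (simp add: right_diff_distrib sum_subtractf)
    moreover have "b x = 0" if "x \<notin> Q" for x
    proof -
      have "x \<notin> R" if "R \<in> F" for R using \<open>x \<notin> Q\<close> FQ(3)[OF that] by blast
      then have "(\<Sum>R\<in>F. oscillation f R x) = 0"
        by (intro sum.neutral) (simp add: oscillation_def)
      then show ?thesis using that unfolding b_def by (simp add: oscillation_def)
    qed
    moreover have "cmod (b x) \<le> 10 * real q ^ 2 * ?A" for x
      unfolding b_def by (rule stopped_part_bounded) (use less.prems assms A F in auto)
    ultimately have "finite_atomic b (7 * (10 * real q ^ 2 * ?A) * mass Q)"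
      using A q_pos less.prems by (intro finite_atomic_bounded) auto
    moreover have "finite_atomic (oscillation f R) (?C * (pmean p f R * mass R))" if "R \<in> F" for R
    proof (rule less.hyps)
      have "R \<noteq> Q" using F(3)[OF that] A by auto
      then show "card R < card Q" using FQ[OF that] Q by (intro psubset_card_mono) auto
    qed (use F that in auto)
    then have "finite_atomic (\<lambda>x. \<Sum>R\<in>F. oscillation f R x) (\<Sum>R\<in>F. ?C * (pmean p f R * mass R))"
      using F(1) by (intro finite_atomic_sum)
    ultimately have "finite_atomic (\<lambda>x. b x + (\<Sum>R\<in>F. oscillation f R x))
        (7 * (10 * real q ^ 2 * ?A) * mass Q + (\<Sum>R\<in>F. ?C * (pmean p f R * mass R)))"
      by (rule finite_atomic_add)
    moreover have "(\<lambda>x. b x + (\<Sum>R\<in>F. oscillation f R x)) = oscillation f Q"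
      unfolding b_def by simp
    moreover have "(\<Sum>R\<in>F. ?C * (pmean p f R * mass R)) \<le> ?C * (?r * (?A * mass Q))"
      unfolding sum_distrib_left[symmetric]
      by (intro mult_left_mono stopped_mass less_imp_le[OF CZ_const(1)]) (use Q F FQ A assms in auto)
    moreover have "7 * (10 * real q ^ 2 * ?A) * mass Q + ?C * (?r * (?A * mass Q))
        = ?C * (?A * mass Q)"
      using arg_cong[OF CZ_const(2)[OF assms(1)], of "\<lambda>z. z * (?A * mass Q)"]
      by (simp add: algebra_simps)
    ultimately show ?thesis by (metis (no_types, lifting) add_left_mono finite_atomic_mono)
  qed
qed

text \<open>The size condition on a (1,p)-atom says precisely that its L^p mean over S is at most
1/mu(S).\<close>
lemma atom_finite_atomic:
  assumes "1 < p" "atom (ereal p) a"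
  shows "finite_atomic a (CZ_const p)"
proof -
  obtain S where S: "CZ_set S" "\<forall>x. a x \<noteq> 0 \<longrightarrow> x \<in> S"
      "energy p a S powr (1 / p) \<le> mass S powr (1 / p - 1)"
      "(\<Sum>x\<in>S. of_real (weight x) * a x) = 0"
    using assms atom_ereal_iff[of p a] unfolding energy_def by auto
  note m = CZ_set_mass_pos[OF S(1)]
  have "pmean p a S * mass S = energy p a S powr (1 / p) / mass S powr (1 / p) * mass S"
    unfolding pmean_def using m energy_nonneg by (simp add: powr_divide)
  also have "\<dots> \<le> mass S powr (1 / p - 1) / mass S powr (1 / p) * mass S"
    using S(3) m by (intro mult_right_mono divide_right_mono) auto
  also have "\<dots> = 1" using m by (simp add: powr_diff)
  finally have "pmean p a S * mass S \<le> 1" .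
  then have "CZ_const p * (pmean p a S * mass S) \<le> CZ_const p"
    using CZ_const(1)[OF assms(1)] by (simp add: mult_le_cancel_left1)
  moreover have "average a S = 0" using S(4) by (simp add: average_def)
  then have "oscillation a S = a" using S(2) by (auto simp: oscillation_def fun_eq_iff)
  ultimately show ?thesis
    using oscillation_atomic[OF assms(1) CZ_set_dyadic[OF S(1)], of a] finite_atomic_mono by simp
qed

section \<open>Atomic series and Hardy norms\<close>

lemma Lp_norm_1:
  "Lp_norm 1 f = (if (\<integral>\<^sup>+x. ennreal (cmod (f x)) \<partial>mu) = \<infinity> then \<infinity>
     else ereal (enn2real (\<integral>\<^sup>+x. ennreal (cmod (f x)) \<partial>mu)))"
proof -
  have "(\<integral>\<^sup>+x. ennreal (cmod (f x) powr 1) \<partial>mu) = (\<integral>\<^sup>+x. ennreal (cmod (f x)) \<partial>mu)" by simp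
  then show ?thesis unfolding Lp_norm_def Let_def by simp
qed

lemma weight_norm_le_Lp_norm_1: "ereal (weight x * cmod (f x)) \<le> Lp_norm 1 f"
proof -
  let ?I = "\<integral>\<^sup>+x. ennreal (cmod (f x)) \<partial>mu"
  have "ennreal (weight x * cmod (f x)) = (\<integral>\<^sup>+y. ennreal (cmod (f y)) * indicator {x} y \<partial>mu)"
    by (subst nn_integral_mu[of "{x}"]) (auto simp: ennreal_mult)
  also have "\<dots> \<le> ?I" by (intro nn_integral_mono) (auto simp: indicator_def)
  finally have le: "ennreal (weight x * cmod (f x)) \<le> ?I" .
  have "weight x * cmod (f x) \<le> enn2real ?I" if "?I \<noteq> \<infinity>"
    using enn2real_mono[OF le] that by (simp add: less_top)
  then show ?thesis unfolding Lp_norm_1 by simp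
qed

text \<open>Every vertex has positive mass, hence convergence in L^1 forces convergence at each vertex.\<close>
lemma decomposition_sums:
  assumes "atomic_decomposition p h c a"
  shows "(\<lambda>j. c j * a j x) sums h x"
proof -
  let ?r = "\<lambda>n. h x - (\<Sum>j<n. c j * a j x)"
  have L: "(\<lambda>n. Lp_norm 1 (\<lambda>x. h x - (\<Sum>j<n. c j * a j x))) \<longlonglongrightarrow> 0"
    using assms unfolding atomic_decomposition_def by blast
  have "(\<lambda>n. ereal (weight x * cmod (?r n))) \<longlonglongrightarrow> 0"
    by (rule tendsto_sandwich[OF _ _ tendsto_const L])
       (use weight_norm_le_Lp_norm_1[of x "\<lambda>x. h x - (\<Sum>j<_. c j * a j x)"] in auto)
  then have "(\<lambda>n. weight x * cmod (?r n)) \<longlonglongrightarrow> 0"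
    unfolding zero_ereal_def by (rule lim_ereal[THEN iffD1])
  then have "(\<lambda>n. inverse (weight x) * (weight x * cmod (?r n))) \<longlonglongrightarrow> inverse (weight x) * 0"
    by (intro tendsto_mult tendsto_const)
  then have "(\<lambda>n. cmod (?r n)) \<longlonglongrightarrow> 0"
    by (simp only: mult.assoc[symmetric] left_inverse[OF weight_nonzero] mult_1_left mult_zero_right)
  then have "?r \<longlonglongrightarrow> 0" by (rule tendsto_norm_zero_cancel)
  then have "(\<lambda>n. h x - ?r n) \<longlonglongrightarrow> h x - 0" by (intro tendsto_diff tendsto_const)
  then show ?thesis unfolding sums_def by simp
qed

lemma atom_infinity_L1:
  assumes "atom \<infinity> a"
  shows "(\<integral>\<^sup>+x. ennreal (cmod (a x)) \<partial>mu) \<le> 1"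
proof -
  obtain S where S: "CZ_set S" "\<forall>x. a x \<noteq> 0 \<longrightarrow> x \<in> S" "\<And>x. cmod (a x) \<le> 1 / mass S"
    using assms unfolding atom_infinity_iff by blast
  have "(\<integral>\<^sup>+x. ennreal (cmod (a x)) \<partial>mu) = (\<Sum>x\<in>S. ennreal (weight x) * ennreal (cmod (a x)))"
    by (rule nn_integral_mu) (use S CZ_set_finite in auto)
  also have "\<dots> = ennreal (\<Sum>x\<in>S. weight x * cmod (a x))" by (simp flip: ennreal_mult)
  finally have eq: "(\<integral>\<^sup>+x. ennreal (cmod (a x)) \<partial>mu) = ennreal (\<Sum>x\<in>S. weight x * cmod (a x))" .
  have "(\<Sum>x\<in>S. weight x * cmod (a x)) \<le> (\<Sum>x\<in>S. weight x * (1 / mass S))"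
    by (intro sum_mono mult_left_mono S) auto
  also have "\<dots> = 1" unfolding sum_distrib_right[symmetric] mass_def[symmetric]
    using CZ_set_mass_pos[OF S(1)] by simp
  finally show ?thesis unfolding eq by simp
qed

lemma atom_infinity_pointwise:
  assumes "atom \<infinity> a"
  shows "cmod (a x) \<le> 1 / weight x"
proof -
  have "ennreal (weight x * cmod (a x)) = (\<integral>\<^sup>+y. ennreal (cmod (a y)) * indicator {x} y \<partial>mu)"
    by (subst nn_integral_mu[of "{x}"]) (auto simp: ennreal_mult)
  also have "\<dots> \<le> (\<integral>\<^sup>+x. ennreal (cmod (a x)) \<partial>mu)"
    by (intro nn_integral_mono) (auto simp: indicator_def)
  also have "\<dots> \<le> 1" using assms by (rule atom_infinity_L1)
  finally show ?thesis using weight_pos[of x] by (simp add: field_simps)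
qed

text \<open>Conversely, pointwise convergence suffices: the L^1 norm of the remainder after n terms is at
most the sum of the moduli of the remaining coefficients, as atoms have L^1 norm at most 1.\<close>
lemma atomic_decompositionI:
  assumes a: "\<And>j. atom \<infinity> (a j)" and c: "summable (\<lambda>j. cmod (c j))"
    and h: "\<And>x. (\<lambda>j. c j * a j x) sums h x"
  shows "atomic_decomposition \<infinity> h c a"
proof -
  let ?tail = "\<lambda>n. \<Sum>j. cmod (c (j + n))"
  have tail: "summable (\<lambda>j. cmod (c (j + n)))" for n using c by (rule summable_ignore_initial_segment)
  have bound: "Lp_norm 1 (\<lambda>x. h x - (\<Sum>j<n. c j * a j x)) \<le> ereal (?tail n)" for n
  proof -
    let ?r = "\<lambda>x. h x - (\<Sum>j<n. c j * a j x)"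
    have "ennreal (cmod (?r x)) \<le> (\<Sum>j. ennreal (cmod (c (j + n) * a (j + n) x)))" for x
    proof -
      have "summable (\<lambda>j. cmod (c (j + n)) * (1 / weight x))"
        using tail by (rule summable_mult2)
      then have s: "summable (\<lambda>j. cmod (c (j + n) * a (j + n) x))"
      proof (rule summable_comparison_test'[where N = 0])
        fix j :: nat
        show "norm (cmod (c (j + n) * a (j + n) x)) \<le> cmod (c (j + n)) * (1 / weight x)"
          unfolding norm_mult real_norm_def abs_mult abs_norm_cancel
          by (intro mult_left_mono) (use atom_infinity_pointwise[OF a] in auto)
      qed
      have "(\<lambda>j. c (j + n) * a (j + n) x) sums ?r x" using h sums_split_initial_segment by blast
      then have "cmod (?r x) \<le> (\<Sum>j. cmod (c (j + n) * a (j + n) x))"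
        using summable_norm[OF s] by (simp add: sums_iff)
      then show ?thesis using s by (simp add: suminf_ennreal2 ennreal_leI)
    qed
    then have "(\<integral>\<^sup>+x. ennreal (cmod (?r x)) \<partial>mu)
        \<le> (\<integral>\<^sup>+x. (\<Sum>j. ennreal (cmod (c (j + n) * a (j + n) x))) \<partial>mu)"
      by (rule nn_integral_mono)
    also have "\<dots> = (\<Sum>j. \<integral>\<^sup>+x. ennreal (cmod (c (j + n) * a (j + n) x)) \<partial>mu)"
      by (rule nn_integral_suminf) simp
    also have "\<dots> \<le> (\<Sum>j. ennreal (cmod (c (j + n))))"
    proof (rule suminf_le)
      fix j
      have "(\<integral>\<^sup>+x. ennreal (cmod (c (j + n) * a (j + n) x)) \<partial>mu)
          = ennreal (cmod (c (j + n))) * (\<integral>\<^sup>+x. ennreal (cmod (a (j + n) x)) \<partial>mu)"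
        by (simp add: norm_mult ennreal_mult nn_integral_cmult)
      also have "\<dots> \<le> ennreal (cmod (c (j + n))) * 1"
        by (intro mult_left_mono atom_infinity_L1 a) auto
      finally show "(\<integral>\<^sup>+x. ennreal (cmod (c (j + n) * a (j + n) x)) \<partial>mu)
          \<le> ennreal (cmod (c (j + n)))" by simp
    qed auto
    also have "\<dots> = ennreal (?tail n)" using tail by (simp add: suminf_ennreal2)
    finally have le: "(\<integral>\<^sup>+x. ennreal (cmod (?r x)) \<partial>mu) \<le> ennreal (?tail n)" .
    then have "(\<integral>\<^sup>+x. ennreal (cmod (?r x)) \<partial>mu) \<noteq> \<infinity>"
      using ennreal_less_top le_less_trans less_irrefl infinity_ennreal_def by metis
    moreover have "enn2real (\<integral>\<^sup>+x. ennreal (cmod (?r x)) \<partial>mu) \<le> ?tail n"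
      using enn2real_mono[OF le] tail by (simp add: suminf_nonneg)
    ultimately show ?thesis unfolding Lp_norm_1 by simp
  qed
  have "?tail \<longlonglongrightarrow> 0" using c by (rule suminf_exist_split2[of "\<lambda>j. cmod (c j)", simplified])
  then have tail_lim: "(\<lambda>n. ereal (?tail n)) \<longlonglongrightarrow> 0" by (simp add: zero_ereal_def)
  have nonneg: "0 \<le> Lp_norm 1 f" for f :: "'v \<Rightarrow> complex"
    using weight_norm_le_Lp_norm_1[of undefined f]
    by (rule order_trans[rotated]) simp
  have lim: "(\<lambda>n. Lp_norm 1 (\<lambda>x. h x - (\<Sum>j<n. c j * a j x))) \<longlonglongrightarrow> 0"
  proof (rule tendsto_sandwich[where f = "\<lambda>_. 0" and h = "\<lambda>n. ereal (?tail n)"])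
    show "\<forall>\<^sub>F n in sequentially. 0 \<le> Lp_norm 1 (\<lambda>x. h x - (\<Sum>j<n. c j * a j x))"
      by (intro always_eventually allI nonneg)
    show "\<forall>\<^sub>F n in sequentially. Lp_norm 1 (\<lambda>x. h x - (\<Sum>j<n. c j * a j x)) \<le> ereal (?tail n)"
      by (intro always_eventually allI bound)
  qed (rule tendsto_const tail_lim)+
  show ?thesis unfolding atomic_decomposition_def by (intro conjI allI a c lim)
qed

lemma finite_atomic_sequence:
  assumes "finite_atomic f K"
  shows "\<exists>b A. (\<forall>i. atom \<infinity> (A i)) \<and> (\<forall>x. (\<lambda>i. b i * A i x) sums f x) \<and>
    summable (\<lambda>i. cmod (b i)) \<and> (\<Sum>i. cmod (b i)) \<le> K"
proof -
  obtain xs where xs: "\<forall>(c, a)\<in>set xs. atom \<infinity> a" "\<And>x. f x = (\<Sum>(c, a)\<leftarrow>xs. c * a x)"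
      "(\<Sum>(c, a)\<leftarrow>xs. cmod c) \<le> K"
    using assms unfolding finite_atomic_def by blast
  \<comment> \<open>the sequence is padded by zero coefficients and the zero function, which is an atom\<close>
  define b where "b i = (if i < length xs then fst (xs ! i) else 0)" for i
  define A where "A i = (if i < length xs then snd (xs ! i) else (\<lambda>x. 0))" for i
  have "CZ_set {undefined}" by (rule CZ_set_singleton)
  then have "atom \<infinity> (\<lambda>x. 0)"
    unfolding atom_infinity_iff using CZ_set_mass_pos
    by (intro exI[of _ "{undefined}"]) (auto intro: less_imp_le)
  then have "atom \<infinity> (A i)" for i
    using xs(1) nth_mem[of i xs] unfolding A_def by (auto simp: case_prod_beta)
  moreover have "(\<lambda>i. b i * A i x) sums f x" for x
  proof -
    have "(\<lambda>i. b i * A i x) sums (\<Sum>i<length xs. b i * A i x)"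
      by (rule sums_finite) (auto simp: b_def)
    moreover have "(\<Sum>i<length xs. b i * A i x) = f x"
      unfolding xs(2) sum_list_sum_nth
      by (auto simp: b_def A_def case_prod_beta lessThan_atLeast0 intro!: sum.cong)
    ultimately show ?thesis by simp
  qed
  moreover have "(\<lambda>i. cmod (b i)) sums (\<Sum>i<length xs. cmod (b i))"
    by (rule sums_finite) (auto simp: b_def)
  moreover have "(\<Sum>i<length xs. cmod (b i)) = (\<Sum>(c, a)\<leftarrow>xs. cmod c)"
    unfolding sum_list_sum_nth
    by (auto simp: b_def case_prod_beta lessThan_atLeast0 intro!: sum.cong)
  ultimately show ?thesis using xs(3) by (intro exI[of _ b] exI[of _ A]) (auto simp: sums_iff)
qed

lemma double_series_prod_decode:
  fixes F :: "nat \<Rightarrow> nat \<Rightarrow> 'b::banach"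
  assumes abs: "\<And>j. summable (\<lambda>i. norm (F j i))" "summable (\<lambda>j. \<Sum>i. norm (F j i))"
    and sums: "\<And>j. F j sums s j" "s sums t"
  shows "(\<lambda>n. case_prod F (prod_decode n)) sums t"
proof -
  have row: "(F j has_sum s j) UNIV" for j
    using abs sums by (intro norm_summable_imp_has_sum)
  have row_abs: "((\<lambda>i. norm (F j i)) has_sum (\<Sum>i. norm (F j i))) UNIV" for j
    using abs(1) by (intro norm_summable_imp_has_sum) (auto simp: summable_sums)
  have "norm (s j) \<le> (\<Sum>i. norm (F j i))" for j
    using summable_norm[OF abs(1)[of j]] sums(1) by (simp add: sums_iff)
  then have "summable (\<lambda>j. norm (s j))"
    by (intro summable_comparison_test'[OF abs(2), of 0]) simp
  then have "(s has_sum t) UNIV" using sums(2) by (rule norm_summable_imp_has_sum)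
  moreover have "(\<lambda>z. norm (case_prod F z)) summable_on (UNIV \<times> UNIV)"
    by (rule summable_on_SigmaI[where g = "\<lambda>j. \<Sum>i. norm (F j i)"])
       (use row_abs abs in \<open>auto intro!: norm_summable_imp_summable_on simp: suminf_nonneg\<close>)
  then have "case_prod F summable_on (UNIV \<times> UNIV)" by (rule abs_summable_summable)
  ultimately have "(case_prod F has_sum t) (UNIV \<times> UNIV)"
    using row by (intro has_sum_SigmaI) auto
  then have "((\<lambda>n. case_prod F (prod_decode n)) has_sum t) UNIV"
    using has_sum_reindex_bij_betw[OF bij_prod_decode, of "case_prod F" t] by simp
  then show ?thesis by (rule has_sum_imp_sums)
qed

text \<open>Each (1,p)-atom of the series is replaced by its finite atomic sum, and the double series is
enumerated along \<open>prod_decode\<close>. Absolute convergence at a vertex x comes from the coefficients, since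
atoms are bounded there by 1 / weight(x).\<close>
lemma decomposition_transfer:
  assumes "1 < p" "atomic_decomposition (ereal p) h c a"
  shows "\<exists>d A. atomic_decomposition \<infinity> h d A \<and> (\<Sum>n. cmod (d n)) \<le> CZ_const p * (\<Sum>j. cmod (c j))"
proof -
  let ?K = "CZ_const p"
  have atoms: "atom (ereal p) (a j)" and c: "summable (\<lambda>j. cmod (c j))" for j
    using assms(2) unfolding atomic_decomposition_def by auto
  have "\<forall>j. \<exists>b A. (\<forall>i. atom \<infinity> (A i)) \<and> (\<forall>x. (\<lambda>i. b i * A i x) sums a j x) \<and>
      summable (\<lambda>i. cmod (b i)) \<and> (\<Sum>i. cmod (b i)) \<le> ?K"
    using finite_atomic_sequence[OF atom_finite_atomic[OF assms(1) atoms]] by blast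
  then obtain b A where A: "\<And>j i. atom \<infinity> (A j i)" and bA: "\<And>j x. (\<lambda>i. b j i * A j i x) sums a j x"
    and b: "\<And>j. summable (\<lambda>i. cmod (b j i))" "\<And>j. (\<Sum>i. cmod (b j i)) \<le> ?K"
    unfolding choice_iff by (elim exE) blast
  define d where "d j i = c j * b j i" for j i
  have d_row: "(\<lambda>i. cmod (d j i)) sums (cmod (c j) * (\<Sum>i. cmod (b j i)))" for j
    unfolding d_def norm_mult using b(1) by (intro sums_mult summable_sums)
  have rows_le: "cmod (c j) * (\<Sum>i. cmod (b j i)) \<le> ?K * cmod (c j)" for j
    using mult_left_mono[OF b(2)[of j] norm_ge_zero[of "c j"]] by (simp only: mult.commute)
  have rows: "summable (\<lambda>j. cmod (c j) * (\<Sum>i. cmod (b j i)))"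
    using rows_le b(1) by (intro summable_comparison_test'[OF summable_mult[OF c], of 0 _ ?K])
      (auto simp: suminf_nonneg)
  have total: "(\<lambda>n. case_prod (\<lambda>j i. cmod (d j i)) (prod_decode n)) sums
      (\<Sum>j. cmod (c j) * (\<Sum>i. cmod (b j i)))"
    using d_row rows by (intro double_series_prod_decode[where s = "\<lambda>j. cmod (c j) * (\<Sum>i. cmod (b j i))"])
      (auto simp: sums_iff summable_sums)
  have pointwise: "(\<lambda>n. case_prod (\<lambda>j i. d j i * A j i x) (prod_decode n)) sums h x" for x
  proof (rule double_series_prod_decode)
    have le: "cmod (d j i * A j i x) \<le> cmod (d j i) * (1 / weight x)" for j i
      unfolding norm_mult using atom_infinity_pointwise[OF A] by (intro mult_left_mono) auto
    have s: "(\<lambda>i. cmod (d j i) * (1 / weight x)) sums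
        (cmod (c j) * (\<Sum>i. cmod (b j i)) * (1 / weight x))" for j
      by (intro sums_mult2 d_row)
    show row: "summable (\<lambda>i. cmod (d j i * A j i x))" for j
      using le by (intro summable_comparison_test'[OF sums_summable[OF s[of j]], of 0]) simp
    have "(\<Sum>i. cmod (d j i * A j i x)) \<le> cmod (c j) * (\<Sum>i. cmod (b j i)) * (1 / weight x)" for j
      using suminf_le[OF le row sums_summable[OF s]] sums_unique[OF s[of j]] by simp
    then show "summable (\<lambda>j. \<Sum>i. cmod (d j i * A j i x))"
      by (intro summable_comparison_test'[OF summable_mult2[OF rows, of "1 / weight x"], of 0])
         (simp add: suminf_nonneg row)
    show "(\<lambda>i. d j i * A j i x) sums (c j * a j x)" for j
      unfolding d_def mult.assoc by (intro sums_mult bA)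
    show "(\<lambda>j. c j * a j x) sums h x" using decomposition_sums[OF assms(2)] .
  qed
  define d' where "d' n = case_prod d (prod_decode n)" for n
  define A' where "A' n = case_prod A (prod_decode n)" for n
  have norm_d': "(\<lambda>n. cmod (d' n)) sums (\<Sum>j. cmod (c j) * (\<Sum>i. cmod (b j i)))"
    using total by (simp add: d'_def case_prod_beta)
  have "atomic_decomposition \<infinity> h d' A'"
  proof (rule atomic_decompositionI)
    show "atom \<infinity> (A' n)" for n by (simp add: A'_def A case_prod_beta)
    show "summable (\<lambda>n. cmod (d' n))" using norm_d' by (rule sums_summable)
    show "(\<lambda>n. d' n * A' n x) sums h x" for x
      using pointwise[of x] by (simp add: d'_def A'_def case_prod_beta)
  qed
  moreover have "(\<Sum>n. cmod (d' n)) \<le> ?K * (\<Sum>j. cmod (c j))"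
    unfolding sums_unique[OF norm_d', symmetric] suminf_mult[OF c]
    using rows rows_le c by (simp add: suminf_le summable_mult flip: suminf_mult)
  ultimately show ?thesis by blast
qed

lemma decomposition_infinity_imp:
  "0 < p \<Longrightarrow> atomic_decomposition \<infinity> h c a \<Longrightarrow> atomic_decomposition (ereal p) h c a"
  unfolding atomic_decomposition_def using atom_infinity_imp_atom by blast

lemma hardy_space_eq: "1 < p \<Longrightarrow> hardy_space (ereal p) = hardy_space \<infinity>"
  unfolding hardy_space_def using decomposition_transfer decomposition_infinity_imp[of p]
  by (auto; blast)

lemma hardy_norm_le:
  "atomic_decomposition p h c a \<Longrightarrow> hardy_norm p h \<le> (\<Sum>j. cmod (c j))"
  unfolding hardy_norm_def
proof (rule cInf_lower)
  show "bdd_below {\<Sum>j. cmod (c j) |c. \<exists>a. atomic_decomposition p h c a}"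
    by (rule bdd_belowI[of _ 0]) (auto simp: atomic_decomposition_def intro!: suminf_nonneg)
qed blast

lemma hardy_norm_greatest:
  assumes "h \<in> hardy_space p" "\<And>c a. atomic_decomposition p h c a \<Longrightarrow> m \<le> (\<Sum>j. cmod (c j))"
  shows "m \<le> hardy_norm p h"
  unfolding hardy_norm_def using assms by (intro cInf_greatest) (auto simp: hardy_space_def)

lemma hardy_norm_equivalence:
  assumes "1 < p" "h \<in> hardy_space \<infinity>"
  shows "hardy_norm (ereal p) h \<le> hardy_norm \<infinity> h"
    "hardy_norm \<infinity> h \<le> CZ_const p * hardy_norm (ereal p) h"
proof -
  note K = CZ_const(1)[OF assms(1)]
  show "hardy_norm (ereal p) h \<le> hardy_norm \<infinity> h"
    using assms by (intro hardy_norm_greatest hardy_norm_le decomposition_infinity_imp) auto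
  have "hardy_norm \<infinity> h / CZ_const p \<le> hardy_norm (ereal p) h"
  proof (rule hardy_norm_greatest)
    fix c a assume "atomic_decomposition (ereal p) h c a"
    then obtain d A where d: "atomic_decomposition \<infinity> h d A"
        "(\<Sum>n. cmod (d n)) \<le> CZ_const p * (\<Sum>j. cmod (c j))"
      using decomposition_transfer assms(1) by blast
    then show "hardy_norm \<infinity> h / CZ_const p \<le> (\<Sum>j. cmod (c j))"
      using hardy_norm_le[OF d(1)] K by (simp add: field_simps)
  qed (use assms hardy_space_eq in auto)
  then show "hardy_norm \<infinity> h \<le> CZ_const p * hardy_norm (ereal p) h"
    using K by (simp add: field_simps)
qed

end

theorem theorem4p4:
  fixes adj :: "'v \<Rightarrow> 'v \<Rightarrow> bool" and q :: nat and g :: "'v set" and N :: "'v \<Rightarrow> int"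
    and p :: real
  assumes "weighted_tree adj q g N" and "1 < p"
  shows "weighted_tree.hardy_space adj q g N (ereal p) = weighted_tree.hardy_space adj q g N \<infinity> \<and>
    (\<exists>c C. 0 < c \<and> 0 < C \<and>
      (\<forall>h \<in> weighted_tree.hardy_space adj q g N \<infinity>.
         c * weighted_tree.hardy_norm adj q g N (ereal p) h \<le> weighted_tree.hardy_norm adj q g N \<infinity> h \<and>
         weighted_tree.hardy_norm adj q g N \<infinity> h \<le> C * weighted_tree.hardy_norm adj q g N (ereal p) h))"
proof -
  interpret weighted_tree adj q g N by fact
  show ?thesis
    using hardy_space_eq[OF assms(2)] hardy_norm_equivalence[OF assms(2)] CZ_const(1)[OF assms(2)]
    by (intro conjI exI[of _ "1 :: real"] exI[of _ "CZ_const p"]) auto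
qed

end
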